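(* Let $S$ be an idempotent semifield and let $V$ be a free $S$-module of finite rank $n$ with basis $e_1,\dots,e_n$. An element of $\bigwedge^dV$ is totally decomposable if and only if its coordinates in the standard basis $\{e_I\}_{I\in\binom{[n]}{d}}$ are the maximal minors of a $d\times n$ matrix over $S$. Thus, the locus of (rank $d$) Stiefel tropical linear spaces in $V$ is in natural bijection, via $[w]\mapsto L_w$, with the locus of totally decomposable tensors in $\mathbb{P}\left(\bigwedge^dV\right)$.
   Context: An idempotent semifield $S$ is a (commutative) semiring satisfying all axioms of a field except the existence of additive inverses, and such that $s+s=s$ for all $s\in S$; its additive and multiplicative identities are $0$ and $1$. Write $[n]=\{1,\dots,n\}$, $I-j=I\smallsetminus\{j\}$, $V^\vee=\mathrm{Hom}_S(V,S)$, and let $x_1,\dots,x_n\in V^\vee$ be the dual basis. The tropical Grassmann algebra of $V$ is $\bigwedge V:=\mathrm{Sym}\,V/\langle e_i^2\sim 0\rangle_{i=1}^n$ (quotient by the generated $S$-algebra congruence), graded by $\bigwedge V=\bigoplus_{d\ge0}\bigwedge^dV$, with commutative product $\wedge$; $\bigwedge^dV$ is free with basis $e_I=e_{i_1}\wedge\cdots\wedge e_{i_d}$, $I\in\binom{[n]}{d}$. $\mathbb{P}(\bigwedge^dV)$ is the set of nonzero elements of $\bigwedge^dV$ modulo multiplication by nonzero scalars. An element of $\bigwedge^dV$ is totally decomposable if it is a wedge product of $d$ elements of $V$. A minor of a matrix over $S$ means the permanent of a square submatrix (the determinant formula with signs omitted); the maximal minors of a $d\times n$ matrix are the permanents of its $d\times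 d$ submatrices, indexed by the column sets $I\in\binom{[n]}{d}$. The tropical hyperplane of a linear form $f=\sum_i f_ix_i\in V^\vee$ is $f^\perp=\{v=\sum_i v_ie_i\in V : \sum_i f_iv_i=\sum_{i\ne j}f_iv_i \text{ for all } j\in[n]\}$. For $w=\sum_I w_Ie_I\in\bigwedge^dV$, $L_w\subset V$ is the intersection of the tropical hyperplanes of the linear forms $\sum_{i\in J}w_{J-i}x_i$, for all $J\in\binom{[n]}{d+1}$; it depends only on the class $[w]$. A rank $d$ Stiefel tropical linear space is one of the form $L_w$ where the coordinates of $w$ are the maximal minors of a $d\times n$ matrix over $S$, not all of these minors being zero. *)

theory Defs
  imports
    "HOL-Library.Multiset"
    "HOL-Library.Poly_Mapping"
    "HOL-Combinatorics.Permutations"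
    "HOL-Algebra.Module"
begin

section \<open>Idempotent semifields and free modules over them\<close>

class idempotent_semifield = comm_semiring_1 +
  assumes add_idem: "a + a = a"
    and ex_inverse: "a \<noteq> 0 \<Longrightarrow> \<exists>b. a * b = 1"

text \<open>The library's modules have an additive group of vectors, so modules over a semiring
  are introduced here.\<close>

locale free_semimodule =
  fixes scale :: "'a::idempotent_semifield \<Rightarrow> 'v::comm_monoid_add \<Rightarrow> 'v" (infixr "*s" 75)
    and n :: nat
    and e :: "nat \<Rightarrow> 'v"
  assumes scale_add_right: "a *s (x + y) = a *s x + a *s y"
    and scale_add_left: "(a + b) *s x = a *s x + b *s x"
    and scale_scale: "a *s (b *s x) = (a * b) *s x"
    and scale_one: "1 *s x = x"
    and scale_zero_left: "0 *s x = 0"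
    and scale_zero_right: "a *s 0 = 0"
    and basis: "\<exists>!c. (\<forall>i. i \<notin> {1..n} \<longrightarrow> c i = 0) \<and> x = (\<Sum>i=1..n. c i *s e i)"

definition dual_basis ::
    "('a::idempotent_semifield \<Rightarrow> 'v::comm_monoid_add \<Rightarrow> 'v) \<Rightarrow> nat \<Rightarrow> (nat \<Rightarrow> 'v) \<Rightarrow> nat \<Rightarrow> 'v \<Rightarrow> 'a"
  where "dual_basis scale n e i v =
    (THE c. (\<forall>k. k \<notin> {1..n} \<longrightarrow> c k = 0) \<and> v = (\<Sum>k=1..n. scale (c k) (e k))) i"

definition index_sets :: "nat \<Rightarrow> nat \<Rightarrow> nat set set"
  where "index_sets n d = {I. I \<subseteq> {1..n} \<and> card I = d}"


section \<open>The tropical Grassmann algebra\<close>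

text \<open>An S-algebra congruence is a congruence for addition and multiplication: in a commutative
  S-algebra, scaling by s is multiplication by the image of s.\<close>

inductive algebra_congruence :: "('b \<Rightarrow> 'b \<Rightarrow> bool) \<Rightarrow> 'b::comm_semiring_1 \<Rightarrow> 'b \<Rightarrow> bool"
  for R :: "'b \<Rightarrow> 'b \<Rightarrow> bool"
  where
    base: "R p q \<Longrightarrow> algebra_congruence R p q"
  | refl: "algebra_congruence R p p"
  | sym: "algebra_congruence R p q \<Longrightarrow> algebra_congruence R q p"
  | trans: "algebra_congruence R p q \<Longrightarrow> algebra_congruence R q r \<Longrightarrow> algebra_congruence R p r"
  | add: "algebra_congruence R p q \<Longrightarrow> algebra_congruence R p' q' \<Longrightarrow>
      algebra_congruence R (p + p') (q + q')"
  | mult: "algebra_congruence R p q \<Longrightarrow> algebra_congruence R p' q' \<Longrightarrow>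
      algebra_congruence R (p * p') (q * q')"

text \<open>The monoid algebra \<open>'v multiset \<Rightarrow>\<^sub>0 'a\<close> is the free commutative S-algebra on the
  underlying set of V (polynomials with one variable for each vector).\<close>

type_synonym ('a, 'v) free_algebra = "'v multiset \<Rightarrow>\<^sub>0 'a"

definition gen :: "'v \<Rightarrow> ('a::idempotent_semifield, 'v) free_algebra"
  where "gen v = Poly_Mapping.single {#v#} 1"

definition const :: "'a::idempotent_semifield \<Rightarrow> ('a, 'v) free_algebra"
  where "const s = Poly_Mapping.single {#} s"

text \<open>The rules \<open>add\<close> and \<open>scale\<close> say that the generators depend linearly on the vector; these
  relations alone present Sym V. Together with \<open>square\<close> they present the quotient of Sym V by
  the congruence generated by the squares of the basis vectors.\<close>

inductive grassmann_rel ::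
    "('a::idempotent_semifield \<Rightarrow> 'v::comm_monoid_add \<Rightarrow> 'v) \<Rightarrow> nat \<Rightarrow> (nat \<Rightarrow> 'v) \<Rightarrow>
      ('a, 'v) free_algebra \<Rightarrow> ('a, 'v) free_algebra \<Rightarrow> bool"
  for scale n e
  where
    add: "grassmann_rel scale n e (gen (v + w)) (gen v + gen w)"
  | scale: "grassmann_rel scale n e (gen (scale s v)) (const s * gen v)"
  | square: "i \<in> {1..n} \<Longrightarrow> grassmann_rel scale n e (gen (e i) ^ 2) 0"

definition grassmann_class ::
    "('a::idempotent_semifield \<Rightarrow> 'v::comm_monoid_add \<Rightarrow> 'v) \<Rightarrow> nat \<Rightarrow> (nat \<Rightarrow> 'v) \<Rightarrow>
      ('a, 'v) free_algebra \<Rightarrow> ('a, 'v) free_algebra set"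
  where "grassmann_class scale n e p = {q. algebra_congruence (grassmann_rel scale n e) p q}"

text \<open>The product \<open>\<otimes>\<close> of this structure is the wedge product. The structure is only a semiring
  with an action of S; it does not satisfy the library's \<open>ring\<close> and \<open>module\<close> locales.\<close>

definition grassmann ::
    "('a::idempotent_semifield \<Rightarrow> 'v::comm_monoid_add \<Rightarrow> 'v) \<Rightarrow> nat \<Rightarrow> (nat \<Rightarrow> 'v) \<Rightarrow>
      ('a, ('a, 'v) free_algebra set) module"
  where "grassmann scale n e =
    (let cl = grassmann_class scale n e in
     \<lparr>carrier = range cl,
      mult = (\<lambda>X Y. \<Union>p\<in>X. \<Union>q\<in>Y. cl (p * q)),
      one = cl 1,
      zero = cl 0,
      add = (\<lambda>X Y. \<Union>p\<in>X. \<Union>q\<in>Y. cl (p + q)),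
      smult = (\<lambda>s X. \<Union>p\<in>X. cl (const s * p))\<rparr>)"

lemma grassmann_class_eq_iff:
  "grassmann_class scale n e p = grassmann_class scale n e q \<longleftrightarrow>
    algebra_congruence (grassmann_rel scale n e) p q"
  unfolding grassmann_class_def
  by (auto intro: algebra_congruence.refl algebra_congruence.sym algebra_congruence.trans)

lemma mem_grassmann_class_iff:
  "q \<in> grassmann_class scale n e p \<longleftrightarrow> algebra_congruence (grassmann_rel scale n e) p q"
  unfolding grassmann_class_def by simp

lemma mem_grassmann_class: "p \<in> grassmann_class scale n e p"
  unfolding grassmann_class_def by (simp add: algebra_congruence.refl)

lemma grassmann_add:
  "grassmann_class scale n e p \<oplus>\<^bsub>grassmann scale n e\<^esub> grassmann_class scale n e q =
    grassmann_class scale n e (p + q)"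
proof -
  let ?cl = "grassmann_class scale n e"
  have "?cl (p' + q') = ?cl (p + q)" if "p' \<in> ?cl p" "q' \<in> ?cl q" for p' q'
    using that unfolding grassmann_class_eq_iff mem_grassmann_class_iff
    by (metis algebra_congruence.add algebra_congruence.sym)
  then have "(\<Union>p'\<in>?cl p. \<Union>q'\<in>?cl q. ?cl (p' + q')) = (\<Union>p'\<in>?cl p. \<Union>q'\<in>?cl q. ?cl (p + q))"
    by (intro SUP_cong[OF HOL.refl])
  moreover have "?cl p \<noteq> {}" "?cl q \<noteq> {}"
    using mem_grassmann_class by blast+
  ultimately show ?thesis
    by (simp add: grassmann_def Let_def)
qed

lemma grassmann_mult:
  "grassmann_class scale n e p \<otimes>\<^bsub>grassmann scale n e\<^esub> grassmann_class scale n e q =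
    grassmann_class scale n e (p * q)"
proof -
  let ?cl = "grassmann_class scale n e"
  have "?cl (p' * q') = ?cl (p * q)" if "p' \<in> ?cl p" "q' \<in> ?cl q" for p' q'
    using that unfolding grassmann_class_eq_iff mem_grassmann_class_iff
    by (metis algebra_congruence.mult algebra_congruence.sym)
  then have "(\<Union>p'\<in>?cl p. \<Union>q'\<in>?cl q. ?cl (p' * q')) = (\<Union>p'\<in>?cl p. \<Union>q'\<in>?cl q. ?cl (p * q))"
    by (intro SUP_cong[OF HOL.refl])
  moreover have "?cl p \<noteq> {}" "?cl q \<noteq> {}"
    using mem_grassmann_class by blast+
  ultimately show ?thesis
    by (simp add: grassmann_def Let_def)
qed

lemma grassmann_smult:
  "s \<odot>\<^bsub>grassmann scale n e\<^esub> grassmann_class scale n e p =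
    grassmann_class scale n e (const s * p)"
proof -
  let ?cl = "grassmann_class scale n e"
  have "?cl (const s * p') = ?cl (const s * p)" if "p' \<in> ?cl p" for p'
    using that unfolding grassmann_class_eq_iff mem_grassmann_class_iff
    by (metis algebra_congruence.mult algebra_congruence.refl algebra_congruence.sym)
  then have "(\<Union>p'\<in>?cl p. ?cl (const s * p')) = (\<Union>p'\<in>?cl p. ?cl (const s * p))"
    by (intro SUP_cong[OF HOL.refl])
  moreover have "?cl p \<noteq> {}"
    using mem_grassmann_class by blast
  ultimately show ?thesis
    by (simp add: grassmann_def Let_def)
qed

definition grassmann_vec ::
    "('a::idempotent_semifield \<Rightarrow> 'v::comm_monoid_add \<Rightarrow> 'v) \<Rightarrow> nat \<Rightarrow> (nat \<Rightarrow> 'v) \<Rightarrow>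
      'v \<Rightarrow> ('a, 'v) free_algebra set"
  where "grassmann_vec scale n e v = grassmann_class scale n e (gen v)"

definition grassmann_deg ::
    "('a::idempotent_semifield \<Rightarrow> 'v::comm_monoid_add \<Rightarrow> 'v) \<Rightarrow> nat \<Rightarrow> (nat \<Rightarrow> 'v) \<Rightarrow>
      nat \<Rightarrow> ('a, 'v) free_algebra set set"
  where "grassmann_deg scale n e d =
    grassmann_class scale n e ` {p. \<forall>m\<in>Poly_Mapping.keys p. size m = d}"

definition basis_wedge ::
    "('a::idempotent_semifield \<Rightarrow> 'v::comm_monoid_add \<Rightarrow> 'v) \<Rightarrow> nat \<Rightarrow> (nat \<Rightarrow> 'v) \<Rightarrow>
      nat set \<Rightarrow> ('a, 'v) free_algebra set"
  where "basis_wedge scale n e I =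
    (\<Otimes>\<^bsub>grassmann scale n e\<^esub>i\<in>I. grassmann_vec scale n e (e i))"

definition grassmann_coord ::
    "('a::idempotent_semifield \<Rightarrow> 'v::comm_monoid_add \<Rightarrow> 'v) \<Rightarrow> nat \<Rightarrow> (nat \<Rightarrow> 'v) \<Rightarrow>
      nat \<Rightarrow> ('a, 'v) free_algebra set \<Rightarrow> nat set \<Rightarrow> 'a"
  where "grassmann_coord scale n e d \<omega> I =
    (THE w. (\<forall>K. K \<notin> index_sets n d \<longrightarrow> w K = 0) \<and>
      \<omega> = (\<Oplus>\<^bsub>grassmann scale n e\<^esub>K\<in>index_sets n d.
             w K \<odot>\<^bsub>grassmann scale n e\<^esub> basis_wedge scale n e K)) I"

definition totally_decomposable ::
    "('a::idempotent_semifield \<Rightarrow> 'v::comm_monoid_add \<Rightarrow> 'v) \<Rightarrow> nat \<Rightarrow> (nat \<Rightarrow> 'v) \<Rightarrow>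
      nat \<Rightarrow> ('a, 'v) free_algebra set \<Rightarrow> bool"
  where "totally_decomposable scale n e d \<omega> \<longleftrightarrow>
    (\<exists>v :: nat \<Rightarrow> 'v. \<omega> = (\<Otimes>\<^bsub>grassmann scale n e\<^esub>i\<in>{1..d}. grassmann_vec scale n e (v i)))"

definition proj_class ::
    "('a::idempotent_semifield \<Rightarrow> 'v::comm_monoid_add \<Rightarrow> 'v) \<Rightarrow> nat \<Rightarrow> (nat \<Rightarrow> 'v) \<Rightarrow>
      ('a, 'v) free_algebra set \<Rightarrow> ('a, 'v) free_algebra set set"
  where "proj_class scale n e \<omega> = {s \<odot>\<^bsub>grassmann scale n e\<^esub> \<omega> | s. s \<noteq> 0}"

definition proj_space ::
    "('a::idempotent_semifield \<Rightarrow> 'v::comm_monoid_add \<Rightarrow> 'v) \<Rightarrow> nat \<Rightarrow> (nat \<Rightarrow> 'v) \<Rightarrow>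
      nat \<Rightarrow> ('a, 'v) free_algebra set set set"
  where "proj_space scale n e d =
    proj_class scale n e ` (grassmann_deg scale n e d - {\<zero>\<^bsub>grassmann scale n e\<^esub>})"

definition totally_decomposable_locus ::
    "('a::idempotent_semifield \<Rightarrow> 'v::comm_monoid_add \<Rightarrow> 'v) \<Rightarrow> nat \<Rightarrow> (nat \<Rightarrow> 'v) \<Rightarrow>
      nat \<Rightarrow> ('a, 'v) free_algebra set set set"
  where "totally_decomposable_locus scale n e d =
    {c \<in> proj_space scale n e d. \<exists>\<omega>\<in>c. totally_decomposable scale n e d \<omega>}"


section \<open>Minors\<close>

definition permanent :: "nat \<Rightarrow> (nat \<Rightarrow> nat \<Rightarrow> 'a::comm_semiring_1) \<Rightarrow> 'a"
  where "permanent d A = (\<Sum>\<sigma> | \<sigma> permutes {1..d}. \<Prod>i=1..d. A i (\<sigma> i))"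

text \<open>A d by n matrix is a function on indices of which only the entries with row in \<open>{1..d}\<close> and
  column in \<open>{1..n}\<close> are used. The columns of the submatrix are those in I, in increasing order
  (list positions start at 0).\<close>

definition maximal_minor :: "nat \<Rightarrow> (nat \<Rightarrow> nat \<Rightarrow> 'a::comm_semiring_1) \<Rightarrow> nat set \<Rightarrow> 'a"
  where "maximal_minor d M I = permanent d (\<lambda>i j. M i (sorted_list_of_set I ! (j - 1)))"


section \<open>Tropical linear spaces\<close>

text \<open>The coefficients of a linear form f in the dual basis are its values \<open>f (e i)\<close>.\<close>

definition tropical_hyperplane ::
    "('a::idempotent_semifield \<Rightarrow> 'v::comm_monoid_add \<Rightarrow> 'v) \<Rightarrow> nat \<Rightarrow> (nat \<Rightarrow> 'v) \<Rightarrow>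
      ('v \<Rightarrow> 'a) \<Rightarrow> 'v set"
  where "tropical_hyperplane scale n e f =
    {v. \<forall>j\<in>{1..n}. (\<Sum>i\<in>{1..n}. f (e i) * dual_basis scale n e i v) =
                   (\<Sum>i\<in>{1..n} - {j}. f (e i) * dual_basis scale n e i v)}"

definition L_space ::
    "('a::idempotent_semifield \<Rightarrow> 'v::comm_monoid_add \<Rightarrow> 'v) \<Rightarrow> nat \<Rightarrow> (nat \<Rightarrow> 'v) \<Rightarrow>
      nat \<Rightarrow> ('a, 'v) free_algebra set \<Rightarrow> 'v set"
  where "L_space scale n e d \<omega> =
    (\<Inter>J\<in>index_sets n (d + 1). tropical_hyperplane scale n e
       (\<lambda>x. \<Sum>i\<in>J. grassmann_coord scale n e d \<omega> (J - {i}) * dual_basis scale n e i x))"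

text \<open>The common value of \<open>L_space\<close> on the representatives of a class.\<close>

definition L_class ::
    "('a::idempotent_semifield \<Rightarrow> 'v::comm_monoid_add \<Rightarrow> 'v) \<Rightarrow> nat \<Rightarrow> (nat \<Rightarrow> 'v) \<Rightarrow>
      nat \<Rightarrow> ('a, 'v) free_algebra set set \<Rightarrow> 'v set"
  where "L_class scale n e d c = the_elem (L_space scale n e d ` c)"

definition stiefel_spaces ::
    "('a::idempotent_semifield \<Rightarrow> 'v::comm_monoid_add \<Rightarrow> 'v) \<Rightarrow> nat \<Rightarrow> (nat \<Rightarrow> 'v) \<Rightarrow>
      nat \<Rightarrow> 'v set set"
  where "stiefel_spaces scale n e d =
    {L_space scale n e d \<omega> | \<omega>. \<omega> \<in> grassmann_deg scale n e d \<and>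
       (\<exists>M. (\<forall>I\<in>index_sets n d. grassmann_coord scale n e d \<omega> I = maximal_minor d M I) \<and>
            (\<exists>I\<in>index_sets n d. maximal_minor d M I \<noteq> 0))}"

end

theory Submission
  imports Defs
begin

text \<open>
  The algebra \<open>\<And>V\<close> is the polynomial algebra in variables that stand for the basis vectors, read modulo
  the squares of the variables. The isomorphism sends \<open>gen v\<close> to the linear form whose coefficients are
  the coordinates of \<open>v\<close>: square-free coefficients are invariant under the congruence
  (\<open>congruent_imp_squarefree_equal\<close>) and square-free monomials in the basis vectors span
  (\<open>spanned_homogeneous\<close>), so the coordinates of a tensor are the square-free coefficients of its
  polynomial. The wedge of d vectors becomes a product of d linear forms. Its coefficient at the
  monomial of \<open>I\<close> is a sum over the bijections from the factors to \<open>I\<close>, which is the permanent on the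
  columns \<open>I\<close> of the matrix whose rows are the vectors (\<open>coord_wedge\<close>). The rows of any matrix are
  coordinate vectors, hence the equivalence.

  For the bijection, well-definedness and surjectivity are formal, and what has to be shown is that
  \<open>L_w\<close> determines \<open>w\<close> up to a scalar when the coordinates of \<open>w\<close> are maximal minors. As the order of
  the semifield may be partial, the proof cannot select terms of a sum that attain the maximum.

  \<^item> Maximal minors satisfy the tropical Pluecker relations. A product of two permanents is a sum over
    pairs of matchings, and exchanging the two matchings along an alternating path turns a pair
    contributing to one term of the relation into a pair of equal weight contributing to another
    term (\<open>matching_swap\<close>, \<open>minor_product_dominated\<close>).

  \<^item> The Pluecker relations say that \<open>L_w\<close> contains, for every \<open>A\<close> with d - 1 elements, the vector
    with entries \<open>w (insert i A)\<close> for \<open>i \<notin> A\<close> and zero on \<open>A\<close>. On a point of \<open>L_w\<close> that vanishes on \<open>A\<close> the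
    equations for the sets \<open>insert i (insert k A)\<close> have only two terms left, which must be equal. If
    the vector is nonzero, they make every such point a multiple of it
    (\<open>vanishing_solution_proportional\<close>).

  \<^item> If \<open>L_w = L_w'\<close>, then \<open>w\<close> and \<open>w'\<close> have the same support, by an exchange argument
    (\<open>support_subset\<close>), and their ratio is the same at two sets of the support that differ in one
    element. The support is the set of bases of a matroid, in which any two bases are joined by
    exchanges, so the ratio is constant (\<open>solutions_determine_ratios\<close>).
\<close>


section \<open>The order of an idempotent semifield\<close>

text \<open>Addition is idempotent, so it is the join of this order. The order need not be total.\<close>

definition dominated :: "'a::idempotent_semifield \<Rightarrow> 'a \<Rightarrow> bool" (infix "\<preceq>" 50)
  where "a \<preceq> b \<longleftrightarrow> a + b = b"

lemma dominated_trans [trans]: "a \<preceq> b \<Longrightarrow> b \<preceq> c \<Longrightarrow> a \<preceq> c"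
  unfolding dominated_def by (metis add.assoc)

lemma dominated_antisym: "a \<preceq> b \<Longrightarrow> b \<preceq> a \<Longrightarrow> a = b"
  unfolding dominated_def by (metis add.commute)

lemma zero_dominated: "0 \<preceq> a"
  by (simp add: dominated_def)

lemma dominated_zero_iff: "a \<preceq> 0 \<longleftrightarrow> a = 0"
  by (simp add: dominated_def)

lemma dominated_add_right: "a \<preceq> a + b"
  unfolding dominated_def by (metis add.assoc add_idem)

lemma add_dominated: "a \<preceq> c \<Longrightarrow> b \<preceq> c \<Longrightarrow> a + b \<preceq> c"
  unfolding dominated_def by (metis add.assoc)

lemma sum_dominated: "(\<And>x. x \<in> A \<Longrightarrow> f x \<preceq> b) \<Longrightarrow> sum f A \<preceq> b"
  by (induction A rule: infinite_finite_induct) (simp_all add: zero_dominated add_dominated)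

lemma dominated_sum: "finite A \<Longrightarrow> x \<in> A \<Longrightarrow> f x \<preceq> sum f A"
  by (simp add: sum.remove dominated_add_right)

lemma semifield_no_zero_divisors:
  fixes a b :: "'a::idempotent_semifield"
  shows "a * b = 0 \<longleftrightarrow> a = 0 \<or> b = 0"
proof -
  have "b = 0" if ab: "a * b = 0" and a: "a \<noteq> 0"
  proof -
    obtain c where "a * c = 1"
      using ex_inverse[OF a] by blast
    then have "b = c * (a * b)"
      by (metis mult.assoc mult.commute mult_1)
    then show ?thesis
      using ab by simp
  qed
  then show ?thesis
    by auto
qed

lemma semifield_mult_cancel:
  fixes a b c :: "'a::idempotent_semifield"
  assumes "c \<noteq> 0" "c * a = c * b"
  shows "a = b"
proof -
  obtain c' where "c * c' = 1"
    using ex_inverse[OF assms(1)] by blast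
  then show ?thesis
    using assms(2) by (metis mult.assoc mult.commute mult_1)
qed

lemma dominated_sum_nonzero:
  assumes "a \<preceq> sum f A" "a \<noteq> 0"
  obtains x where "x \<in> A" "f x \<noteq> 0"
  using assms by (metis dominated_zero_iff sum.neutral)


section \<open>Tropical linear spaces in coordinates\<close>

text \<open>The coordinate vectors of the points of \<open>L_w\<close>. The condition that a sum keeps its value when the
  term of index \<open>j\<close> is dropped says, addition being idempotent, that this term is dominated by the sum
  of the others; in this form it can be verified one term at a time.\<close>

definition tropical_solutions :: "nat \<Rightarrow> nat \<Rightarrow> (nat set \<Rightarrow> 'a::idempotent_semifield) \<Rightarrow> (nat \<Rightarrow> 'a) set"
  where "tropical_solutions n d W =
    {x. \<forall>J\<in>index_sets n (d + 1). \<forall>j\<in>J.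
      W (J - {j}) * x j \<preceq> (\<Sum>i\<in>J - {j}. W (J - {i}) * x i)}"

text \<open>When \<open>W\<close> is the basis indicator of a matroid of rank d and \<open>A\<close> is independent with d - 1 elements,
  the support of this vector is the complement of the hyperplane spanned by \<open>A\<close>, that is, a
  cocircuit.\<close>

definition cocircuit :: "(nat set \<Rightarrow> 'a::idempotent_semifield) \<Rightarrow> nat set \<Rightarrow> nat \<Rightarrow> 'a"
  where "cocircuit W A i = (if i \<in> A then 0 else W (insert i A))"

text \<open>For fixed \<open>A\<close>, \<open>J\<close> and \<open>j\<close>, the membership on the right says that the term of index \<open>j\<close> in
  \<open>\<Sum>i\<in>J - A. W (J - {i}) * W (insert i A)\<close> is dominated by the sum of the other terms. These are the
  tropical Pluecker relations.\<close>

definition tropical_pluecker :: "nat \<Rightarrow> nat \<Rightarrow> (nat set \<Rightarrow> 'a::idempotent_semifield) \<Rightarrow> bool"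
  where "tropical_pluecker n d W \<longleftrightarrow>
    (\<forall>A. A \<subseteq> {1..n} \<longrightarrow> Suc (card A) = d \<longrightarrow> cocircuit W A \<in> tropical_solutions n d W)"

lemma finite_index_set: "I \<in> index_sets n d \<Longrightarrow> finite I"
  by (auto simp: index_sets_def intro: finite_subset)

lemma finite_index_sets: "finite (index_sets n d)"
  by (rule finite_subset[of _ "Pow {1..n}"]) (auto simp: index_sets_def)

lemma insert_index_set:
  "I \<in> index_sets n d \<Longrightarrow> j \<in> {1..n} \<Longrightarrow> j \<notin> I \<Longrightarrow> insert j I \<in> index_sets n (d + 1)"
  using finite_index_set[of I n d] by (simp add: index_sets_def)

lemma exchange_index_set:
  assumes "I \<in> index_sets n d" "i \<in> I" "j \<in> {1..n}" "j \<notin> I"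
  shows "insert j (I - {i}) \<in> index_sets n d"
  using assms finite_index_set[of I n d] card_Diff_singleton[of i I] card_gt_0_iff[of I]
  by (auto simp: index_sets_def)

lemma index_set_eqI:
  assumes "I \<in> index_sets n d" "I' \<in> index_sets n d" "I - I' = {}"
  shows "I = I'"
  using assms card_subset_eq[OF finite_index_set[OF assms(2)]] by (auto simp: index_sets_def)

lemma cocircuit_solution:
  assumes "tropical_pluecker n d W" "I \<in> index_sets n d" "a \<in> I"
  shows "cocircuit W (I - {a}) \<in> tropical_solutions n d W"
proof -
  have "I - {a} \<subseteq> {1..n}" "Suc (card (I - {a})) = d"
    using assms card_Suc_Diff1[OF finite_index_set] by (auto simp: index_sets_def)
  then show ?thesis
    using assms(1) by (simp add: tropical_pluecker_def)
qed

text \<open>The support of a Pluecker vector is the set of bases of a matroid: apply the Pluecker relation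
  for \<open>I - {a}\<close> and \<open>insert a I'\<close> to its term of index \<open>a\<close>, which is \<open>W I' * W I\<close>. A product of nonzero
  elements is nonzero, so some other term is nonzero as well.\<close>

lemma basis_exchange:
  assumes W: "tropical_pluecker n d W"
    and I: "I \<in> index_sets n d" "W I \<noteq> 0" and I': "I' \<in> index_sets n d" "W I' \<noteq> 0"
    and a: "a \<in> I - I'"
  obtains b where "b \<in> I' - I" "W (insert b (I - {a})) \<noteq> 0"
proof -
  have an: "a \<in> {1..n}"
    using a I by (auto simp: index_sets_def)
  have "insert a I' \<in> index_sets n (d + 1)"
    using insert_index_set[OF I'(1) an] a by simp
  moreover have "cocircuit W (I - {a}) \<in> tropical_solutions n d W"
    using cocircuit_solution[OF W I(1)] a by simp
  ultimately have "W (insert a I' - {a}) * cocircuit W (I - {a}) a \<preceq>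
      (\<Sum>i\<in>insert a I' - {a}. W (insert a I' - {i}) * cocircuit W (I - {a}) i)"
    unfolding tropical_solutions_def by blast
  moreover have "W (insert a I' - {a}) * cocircuit W (I - {a}) a \<noteq> 0"
    using a I(2) I'(2) by (simp add: cocircuit_def semifield_no_zero_divisors insert_absorb)
  ultimately obtain b where "b \<in> insert a I' - {a}" "W (insert a I' - {b}) * cocircuit W (I - {a}) b \<noteq> 0"
    by (rule dominated_sum_nonzero)
  with that show thesis
    by (auto simp: cocircuit_def semifield_no_zero_divisors split: if_splits)
qed

text \<open>For \<open>J = insert i (insert k A)\<close> only the terms of index \<open>i\<close> and \<open>k\<close> survive in the equation of the
  solution \<open>x\<close>. Two terms that dominate each other are equal. Thus the solutions that vanish
  on \<open>A\<close> are multiples of \<open>cocircuit W A\<close>, as soon as this vector is nonzero.\<close>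

lemma vanishing_solution_proportional:
  assumes x: "x \<in> tropical_solutions n d W" and A: "A \<subseteq> {1..n}" "Suc (card A) = d"
    and van: "\<And>a. a \<in> A \<Longrightarrow> x a = 0"
    and ik: "i \<in> {1..n} - A" "k \<in> {1..n} - A"
  shows "W (insert k A) * x i = W (insert i A) * x k"
proof (cases "i = k")
  case False
  have dom: "W (insert k A) * x i \<preceq> W (insert i A) * x k"
    if ik: "i \<in> {1..n} - A" "k \<in> {1..n} - A" "i \<noteq> k" for i k
  proof -
    let ?J = "insert i (insert k A)"
    have "?J \<in> index_sets n (d + 1)"
      using ik A finite_subset[OF A(1)] by (simp add: index_sets_def)
    then have "W (?J - {i}) * x i \<preceq> (\<Sum>l\<in>?J - {i}. W (?J - {l}) * x l)"
      using x unfolding tropical_solutions_def by blast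
    also have "?J - {i} = insert k A"
      using ik by auto
    also have "(\<Sum>l\<in>insert k A. W (?J - {l}) * x l) = W (?J - {k}) * x k"
      using ik van finite_subset[OF A(1)] by simp
    also have "?J - {k} = insert i A"
      using ik by auto
    finally show ?thesis .
  qed
  show ?thesis
    using dom[of i k] dom[of k i] ik False by (blast intro: dominated_antisym)
qed simp

text \<open>For \<open>i \<in> I\<close> the vector \<open>cocircuit W (I - {i})\<close> is a solution for \<open>W\<close>, hence for \<open>W'\<close>, and it is
  nonzero at \<open>i\<close> but at no other element of \<open>I\<close>. If \<open>I'\<close> is in the support of \<open>W'\<close> and misses \<open>i\<close>, the
  equation of \<open>W'\<close> for \<open>insert i I'\<close>, evaluated at this vector, shows that \<open>i\<close> can be exchanged for some
  \<open>k \<in> I' - I\<close> within the support of \<open>W'\<close>. So the member of this support that is closest to \<open>I\<close> is \<open>I\<close>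
  itself.\<close>

lemma support_subset:
  assumes W: "tropical_pluecker n d W"
    and sub: "tropical_solutions n d W \<subseteq> tropical_solutions n d W'"
    and nz: "\<exists>I\<in>index_sets n d. W' I \<noteq> 0"
    and I: "I \<in> index_sets n d" "W I \<noteq> 0"
  shows "W' I \<noteq> 0"
proof -
  define B where "B = {I'\<in>index_sets n d. W' I' \<noteq> 0}"
  have "\<exists>I'. I' \<in> B \<and> (\<forall>K. K \<in> B \<longrightarrow> card (I - I') \<le> card (I - K))"
    using nz ex_has_least_nat[of "\<lambda>K. K \<in> B" _ "\<lambda>K. card (I - K)"] by (auto simp: B_def)
  then obtain I' where I': "I' \<in> B" and least: "\<And>K. K \<in> B \<Longrightarrow> card (I - I') \<le> card (I - K)"
    by blast
  have "I - I' = {}"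
  proof (rule ccontr)
    assume "I - I' \<noteq> {}"
    then obtain i where i: "i \<in> I" "i \<notin> I'"
      by blast
    \<comment> \<open>exchange some element of \<open>I'\<close> for \<open>i\<close>, contradicting the choice of \<open>I'\<close>\<close>
    have fin: "finite I"
      using I(1) by (rule finite_index_set)
    have i_n: "i \<in> {1..n}"
      using i I by (auto simp: index_sets_def)
    let ?u = "cocircuit W (I - {i})" and ?J = "insert i I'"
    have "?u \<in> tropical_solutions n d W'"
      using cocircuit_solution[OF W I(1) i(1)] sub by blast
    moreover have "?J \<in> index_sets n (d + 1)"
      using insert_index_set i_n i I' by (simp add: B_def)
    ultimately have "W' (?J - {i}) * ?u i \<preceq> (\<Sum>k\<in>?J - {i}. W' (?J - {k}) * ?u k)"
      unfolding tropical_solutions_def by blast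
    moreover have "W' (?J - {i}) * ?u i \<noteq> 0"
      using i I' I(2) by (simp add: B_def cocircuit_def semifield_no_zero_divisors insert_absorb)
    ultimately obtain k where "k \<in> ?J - {i}" "W' (?J - {k}) * ?u k \<noteq> 0"
      by (rule dominated_sum_nonzero)
    then have k: "k \<in> I'" "k \<notin> I" "W' (insert i (I' - {k})) \<noteq> 0"
      using i by (auto simp: cocircuit_def semifield_no_zero_divisors insert_Diff_if split: if_splits)
    then have "insert i (I' - {k}) \<in> B"
      using exchange_index_set[of I' n d k i] I' i i_n by (simp add: B_def)
    then have "card (I - I') \<le> card (I - insert i (I' - {k}))"
      by (rule least)
    also have "I - insert i (I' - {k}) = (I - I') - {i}"
      using k by auto
    also have "card \<dots> < card (I - I')"
      using i fin by (intro card_Diff1_less) auto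
    finally show False
      by simp
  qed
  then have "I = I'"
    using index_set_eqI I(1) I' by (auto simp: B_def)
  then show ?thesis
    using I' by (simp add: B_def)
qed

text \<open>If \<open>I\<close> and \<open>I'\<close> differ in one element, \<open>A\<close> being what they share, the ratio of \<open>W\<close> on them is
  a ratio of entries of \<open>cocircuit W A\<close>. This vector solves the equations of \<open>W'\<close> and vanishes on \<open>A\<close>, so
  the ratio is the same for \<open>W'\<close>. Basis exchange joins any two sets in the support by a chain of such
  pairs.\<close>

lemma solutions_determine_ratios:
  assumes W: "tropical_pluecker n d W"
    and sub: "tropical_solutions n d W \<subseteq> tropical_solutions n d W'"
    and I: "I \<in> index_sets n d" "W I \<noteq> 0" and I': "I' \<in> index_sets n d" "W I' \<noteq> 0"
  shows "W I * W' I' = W I' * W' I"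
  using I
proof (induction "card (I - I')" arbitrary: I rule: less_induct)
  case less
  have fin: "finite I"
    using less.prems(1) by (rule finite_index_set)
  show ?case
  proof (cases "I - I' = {}")
    case True
    then show ?thesis
      using index_set_eqI less.prems(1) I'(1) by (metis mult.commute)
  next
    case False
    then obtain a where a: "a \<in> I - I'"
      by blast
    from basis_exchange[OF W less.prems I' a] obtain b
      where b: "b \<in> I' - I" and nz: "W (insert b (I - {a})) \<noteq> 0" .
    \<comment> \<open>\<open>?K\<close> is one exchange step closer to \<open>I'\<close>; \<open>I\<close> and \<open>?K\<close> share \<open>?A\<close>\<close>
    let ?A = "I - {a}"
    let ?K = "insert b ?A"
    have bn: "b \<in> {1..n}" and an: "a \<in> {1..n}" and A: "?A \<subseteq> {1..n}"
      using a b less.prems(1) I'(1) by (auto simp: index_sets_def)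
    have K: "?K \<in> index_sets n d"
      using exchange_index_set less.prems(1) a b bn by simp
    have cA: "Suc (card ?A) = d"
      using a card_Suc_Diff1[OF fin] less.prems(1) by (auto simp: index_sets_def)
    have sol: "cocircuit W ?A \<in> tropical_solutions n d W'"
      using cocircuit_solution[OF W less.prems(1)] a sub by blast
    have "W' ?K * cocircuit W ?A a = W' (insert a ?A) * cocircuit W ?A b"
      using a b an bn
      by (intro vanishing_solution_proportional[OF sol A cA]) (auto simp: cocircuit_def)
    then have IK: "W' ?K * W I = W' I * W ?K"
      using a b by (simp add: cocircuit_def insert_absorb)
    have "?K - I' = (I - I') - {a}"
      using a b by auto
    moreover have "card ((I - I') - {a}) < card (I - I')"
      using a fin by (intro card_Diff1_less) auto
    ultimately have KI': "W ?K * W' I' = W I' * W' ?K"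
      using less.hyps[OF _ K nz] by simp
    have "W ?K * (W I * W' I') = W I * (W I' * W' ?K)"
      using KI' by (metis mult.left_commute)
    also have "\<dots> = W ?K * (W I' * W' I)"
      using IK by (metis mult.left_commute mult.commute)
    finally show ?thesis
      by (rule semifield_mult_cancel[OF nz])
  qed
qed

text \<open>The supports agree by \<open>support_subset\<close> and the ratios by \<open>solutions_determine_ratios\<close>, so one
  scalar, read off at any set \<open>B\<close> in the support, carries \<open>W\<close> to \<open>W'\<close>.\<close>

theorem solutions_determine_pluecker_vector:
  fixes W W' :: "nat set \<Rightarrow> 'a::idempotent_semifield"
  assumes W: "tropical_pluecker n d W" "\<exists>I\<in>index_sets n d. W I \<noteq> 0"
    and W': "tropical_pluecker n d W'" "\<exists>I\<in>index_sets n d. W' I \<noteq> 0"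
    and eq: "tropical_solutions n d W = tropical_solutions n d W'"
  obtains t where "t \<noteq> 0" "\<And>I. I \<in> index_sets n d \<Longrightarrow> W' I = t * W I"
proof -
  obtain B where B: "B \<in> index_sets n d" "W B \<noteq> 0"
    using W(2) by blast
  obtain c where c: "W B * c = 1"
    using ex_inverse[OF B(2)] by blast
  have supp: "W I = 0 \<longleftrightarrow> W' I = 0" if "I \<in> index_sets n d" for I
    using support_subset[OF W(1) _ W'(2)] support_subset[OF W'(1) _ W(2)] eq that by blast
  show thesis
  proof
    show "c * W' B \<noteq> 0"
      using c B supp by (auto simp: semifield_no_zero_divisors)
    show "W' I = c * W' B * W I" if I: "I \<in> index_sets n d" for I
    proof (cases "W I = 0")
      case True
      then show ?thesis
        using supp[OF I] by (metis mult_zero_right)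
    next
      case False
      have "W I * W' B = W B * W' I"
        using solutions_determine_ratios[OF W(1) _ I False B] eq by simp
      then show ?thesis
        using c by (metis mult.assoc mult.commute mult_1)
    qed
  qed
qed


section \<open>Permanents as sums over matchings\<close>

text \<open>Functions are extensional so that each bijection is counted once in sums over this set.\<close>

definition matchings :: "nat set \<Rightarrow> nat set \<Rightarrow> (nat \<Rightarrow> nat) set"
  where "matchings D I = {f \<in> D \<rightarrow>\<^sub>E I. bij_betw f D I}"

lemma finite_matchings: "finite D \<Longrightarrow> finite I \<Longrightarrow> finite (matchings D I)"
  by (simp add: matchings_def finite_PiE)

lemma matchingsI: "bij_betw f D I \<Longrightarrow> f \<in> extensional D \<Longrightarrow> f \<in> matchings D I"
  by (auto simp: matchings_def PiE_def bij_betw_def)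

text \<open>Composing a permutation of the rows with the increasing enumeration of \<open>I\<close> gives a bijection from
  the rows to \<open>I\<close>, and every bijection arises once. The sum over bijections no longer mentions an order
  on the columns, which makes it easier to relate minors on different column sets.\<close>

lemma maximal_minor_eq_sum_matchings:
  fixes M :: "nat \<Rightarrow> nat \<Rightarrow> 'a::comm_semiring_1"
  assumes I: "finite I" "card I = d"
  shows "maximal_minor d M I = (\<Sum>f\<in>matchings {1..d} I. \<Prod>i=1..d. M i (f i))"
proof -
  define s where "s = (\<lambda>j. sorted_list_of_set I ! (j - 1))"
  have "bij_betw (\<lambda>j. j - 1) {1..d} {..<d}"
    by (rule bij_betw_byWitness[of _ Suc]) auto
  moreover have "bij_betw (\<lambda>j. sorted_list_of_set I ! j) {..<d} I"
    using I by (intro bij_betw_nth) auto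
  ultimately have s: "bij_betw s {1..d} I"
    unfolding s_def by (rule bij_betw_trans[unfolded comp_def])
  define r where "r = inv_into {1..d} s"
  have r: "bij_betw r I {1..d}"
    unfolding r_def using s by (rule bij_betw_inv_into)
  have sr: "s (r i) = i" if "i \<in> I" for i
    using s that unfolding r_def by (simp add: bij_betw_inv_into_right)
  have rs: "r (s i) = i" if "i \<in> {1..d}" for i
    using s that unfolding r_def by (simp add: bij_betw_inv_into_left)
  show ?thesis
    unfolding maximal_minor_def permanent_def s_def[symmetric]
  proof (rule sum.reindex_bij_witness[where
        j = "\<lambda>\<sigma>. restrict (s \<circ> \<sigma>) {1..d}" and
        i = "\<lambda>f j. if j \<in> {1..d} then r (f j) else j"])
    fix \<sigma> assume "\<sigma> \<in> {\<sigma>. \<sigma> permutes {1..d}}"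
    then have \<sigma>: "\<sigma> permutes {1..d}" by simp
    have \<sigma>in: "\<sigma> j \<in> {1..d}" if "j \<in> {1..d}" for j
      using permutes_in_image[OF \<sigma>] that by blast
    have "r (restrict (s \<circ> \<sigma>) {1..d} j) = \<sigma> j" if "j \<in> {1..d}" for j
      using rs[OF \<sigma>in[OF that]] that by simp
    then show "(\<lambda>j. if j \<in> {1..d} then r (restrict (s \<circ> \<sigma>) {1..d} j) else j) = \<sigma>"
      using permutes_not_in[OF \<sigma>] by (intro ext) metis
    have "bij_betw (s \<circ> \<sigma>) {1..d} I"
      using bij_betw_trans[OF permutes_imp_bij[OF \<sigma>] s] .
    then show "restrict (s \<circ> \<sigma>) {1..d} \<in> matchings {1..d} I"
      by (intro matchingsI) (simp_all del: restrict_apply add: bij_betw_restrict_eq)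
  next
    fix f assume "f \<in> matchings {1..d} I"
    then have f: "bij_betw f {1..d} I" "f \<in> extensional {1..d}"
      by (auto simp: matchings_def PiE_def)
    have fin: "f j \<in> I" if "j \<in> {1..d}" for j
      using f(1) that by (rule bij_betwE[rule_format])
    let ?\<sigma> = "\<lambda>j. if j \<in> {1..d} then r (f j) else j"
    have "restrict (s \<circ> ?\<sigma>) {1..d} j = f j" for j
      using f(2) fin sr by (cases "j \<in> {1..d}") (auto simp: extensional_def)
    then show "restrict (s \<circ> ?\<sigma>) {1..d} = f"
      by blast
    have "bij_betw (r \<circ> f) {1..d} {1..d}"
      using f(1) r by (rule bij_betw_trans)
    then have "bij_betw ?\<sigma> {1..d} {1..d}"
      by (rule bij_betw_cong[THEN iffD1, rotated]) auto
    then show "?\<sigma> \<in> {\<sigma>. \<sigma> permutes {1..d}}"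
      by (auto intro: bij_imp_permutes)
  qed (auto simp: s_def)
qed

lemma bij_betw_fun_upd:
  assumes "bij_betw f (D - {r}) Z" "r \<in> D" "y \<notin> Z"
  shows "bij_betw (f(r := y)) D (insert y Z)"
proof -
  have "bij_betw (f(r := y)) (D - {r}) Z"
    using assms(1) by (rule bij_betw_cong[THEN iffD1, rotated]) simp
  then have "bij_betw (f(r := y)) (D - {r} \<union> {r}) (Z \<union> {(f(r := y)) r})"
    using assms(3) by (intro notIn_Un_bij_betw) simp_all
  then show ?thesis
    using assms(2) by (simp add: insert_absorb)
qed

lemma bij_betw_Diff_singleton:
  assumes "bij_betw f D X" "r \<in> D"
  shows "bij_betw f (D - {r}) (X - {f r})"
  using assms by (metis bij_betw_DiffI bij_betw_singletonI empty_subsetI insert_subset bij_betwE)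

text \<open>View \<open>f\<close> and \<open>g\<close> as two matchings between rows and columns. Starting in the column \<open>j\<close>, which only \<open>g\<close>
  covers, an alternating path leads along \<open>g\<close> to a row, along \<open>f\<close> to a column, and so on until it ends in
  a column \<open>i\<close> that only \<open>f\<close> covers. Exchanging \<open>f\<close> and \<open>g\<close> on the rows of this path moves \<open>j\<close> to the image
  of the first and \<open>i\<close> to that of the second. The induction removes the first row of the path.\<close>

lemma matching_swap:
  assumes "finite D" "bij_betw f D X" "bij_betw g D Y" "j \<in> Y - X"
  shows "\<exists>i f' g'. i \<in> X - Y \<and> bij_betw f' D (insert j (X - {i})) \<and>
    bij_betw g' D (insert i (Y - {j})) \<and>
    (\<forall>r\<in>D. (f' r = f r \<and> g' r = g r) \<or> (f' r = g r \<and> g' r = f r))"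
  using assms
proof (induction "card D" arbitrary: D X Y j rule: less_induct)
  case less
  obtain r where r: "r \<in> D" "g r = j"
    using less.prems(3,4) by (auto simp: bij_betw_def)
  let ?D = "D - {r}" and ?c = "f r"
  have c: "?c \<in> X"
    using less.prems(2) r(1) bij_betwE by blast
  have cj: "?c \<noteq> j"
    using c less.prems(4) by auto
  have f: "bij_betw f ?D (X - {?c})"
    using bij_betw_Diff_singleton[OF less.prems(2) r(1)] .
  have g: "bij_betw g ?D (Y - {j})"
    using bij_betw_Diff_singleton[OF less.prems(3) r(1)] r(2) by simp
  show ?case
  proof (cases "?c \<in> Y")
    case False
    \<comment> \<open>the path ends in the column \<open>?c\<close>\<close>
    have "bij_betw (f(r := j)) D (insert j (X - {?c}))"
      using f r(1) less.prems(4) by (intro bij_betw_fun_upd) auto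
    moreover have "bij_betw (g(r := ?c)) D (insert ?c (Y - {j}))"
      using g r(1) False by (intro bij_betw_fun_upd) auto
    ultimately show ?thesis
      using c False r(2) by (intro exI[of _ ?c] exI[of _ "f(r := j)"] exI[of _ "g(r := ?c)"]) auto
  next
    case True
    \<comment> \<open>the path continues from \<open>?c\<close>, which \<open>f\<close> no longer covers once the row \<open>r\<close> is removed\<close>
    have "card ?D < card D"
      using less.prems(1) r(1) by (intro card_Diff1_less)
    then obtain i f' g' where i: "i \<in> (X - {?c}) - (Y - {j})"
      and f': "bij_betw f' ?D (insert ?c (X - {?c} - {i}))"
      and g': "bij_betw g' ?D (insert i (Y - {j} - {?c}))"
      and sw: "\<forall>r\<in>?D. (f' r = f r \<and> g' r = g r) \<or> (f' r = g r \<and> g' r = f r)"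
      using less.hyps[of ?D "X - {?c}" "Y - {j}" ?c] f g True cj less.prems(1) by auto
    have iY: "i \<in> X - Y"
      using i less.prems(4) by auto
    have "bij_betw (f'(r := j)) D (insert j (insert ?c (X - {?c} - {i})))"
      using f' r(1) less.prems(4) cj by (intro bij_betw_fun_upd) auto
    also have "insert ?c (X - {?c} - {i}) = X - {i}"
      using c i by auto
    finally have "bij_betw (f'(r := j)) D (insert j (X - {i}))" .
    moreover have "bij_betw (g'(r := ?c)) D (insert ?c (insert i (Y - {j} - {?c})))"
      using g' r(1) i by (intro bij_betw_fun_upd) auto
    moreover have "insert ?c (insert i (Y - {j} - {?c})) = insert i (Y - {j})"
      using True cj by auto
    ultimately show ?thesis
      using iY sw r(2) by (intro exI[of _ i] exI[of _ "f'(r := j)"] exI[of _ "g'(r := ?c)"]) auto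
  qed
qed

text \<open>Every term of the left-hand product belongs to a pair of matchings. The swapped pair has the same
  product of entries, as only the roles of the two factors in some rows change, so the term also occurs on
  the right.\<close>

lemma minor_product_dominated:
  fixes M :: "nat \<Rightarrow> nat \<Rightarrow> 'a::idempotent_semifield"
  assumes D: "finite D" and fin: "finite X" "finite Y" and j: "j \<in> Y - X"
  defines "p \<equiv> \<lambda>I. \<Sum>f\<in>matchings D I. \<Prod>r\<in>D. M r (f r)"
  shows "p X * p Y \<preceq> (\<Sum>i\<in>X - Y. p (insert j (X - {i})) * p (insert i (Y - {j})))"
    (is "_ \<preceq> ?S")
proof -
  have "(\<Prod>r\<in>D. M r (f r)) * (\<Prod>r\<in>D. M r (g r)) \<preceq> ?S"
    if fg: "f \<in> matchings D X" "g \<in> matchings D Y" for f g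
  proof -
    from fg have "bij_betw f D X" "bij_betw g D Y"
      by (auto simp: matchings_def)
    from matching_swap[OF D this j] obtain i f' g' where i: "i \<in> X - Y"
      and f': "bij_betw f' D (insert j (X - {i}))" and g': "bij_betw g' D (insert i (Y - {j}))"
      and sw: "\<forall>r\<in>D. (f' r = f r \<and> g' r = g r) \<or> (f' r = g r \<and> g' r = f r)"
      by blast
    define F G where "F = restrict f' D" and "G = restrict g' D"
    have F: "F \<in> matchings D (insert j (X - {i}))" and G: "G \<in> matchings D (insert i (Y - {j}))"
      using f' g' by (auto simp: F_def G_def intro!: matchingsI cong: bij_betw_cong)
    have "(\<Prod>r\<in>D. M r (f r)) * (\<Prod>r\<in>D. M r (g r)) = (\<Prod>r\<in>D. M r (f r) * M r (g r))"
      by (simp add: prod.distrib)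
    also have "\<dots> = (\<Prod>r\<in>D. M r (F r) * M r (G r))"
      using sw by (intro prod.cong) (auto simp: F_def G_def mult.commute)
    also have "\<dots> = (\<Prod>r\<in>D. M r (F r)) * (\<Prod>r\<in>D. M r (G r))"
      by (simp add: prod.distrib)
    also have "\<dots> \<preceq> p (insert j (X - {i})) * p (insert i (Y - {j}))"
    proof -
      let ?P = "\<lambda>f. \<Prod>r\<in>D. M r (f r)"
      have "(\<lambda>(F, G). ?P F * ?P G) (F, G) \<preceq>
          (\<Sum>(F, G)\<in>matchings D (insert j (X - {i})) \<times> matchings D (insert i (Y - {j})). ?P F * ?P G)"
        using F G D fin by (intro dominated_sum) (auto intro: finite_matchings)
      then show ?thesis
        by (simp add: p_def sum_product sum.cartesian_product)
    qed
    also have "\<dots> \<preceq> ?S"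
      using i fin by (intro dominated_sum[of _ _ "\<lambda>i. p (insert j (X - {i})) * p (insert i (Y - {j}))"]) auto
    finally show ?thesis .
  qed
  then show ?thesis
    unfolding p_def sum_product by (intro sum_dominated)
qed

text \<open>This is \<open>minor_product_dominated\<close> for \<open>X = J - {j}\<close> and \<open>Y = insert j A\<close>.\<close>

theorem tropical_pluecker_maximal_minors:
  fixes M :: "nat \<Rightarrow> nat \<Rightarrow> 'a::idempotent_semifield"
  assumes W: "\<And>I. I \<in> index_sets n d \<Longrightarrow> W I = maximal_minor d M I"
  shows "tropical_pluecker n d W"
  unfolding tropical_pluecker_def tropical_solutions_def
proof safe
  fix A J j assume A: "A \<subseteq> {1..n}" "d = Suc (card A)" and J: "J \<in> index_sets n (Suc (card A) + 1)" and j: "j \<in> J"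
  note J = J[folded A(2)]
  have fin: "finite A" "finite J"
    using A(1) J by (auto intro: finite_subset finite_index_set)
  define p where "p I = (\<Sum>f\<in>matchings {1..d} I. \<Prod>r\<in>{1..d}. M r (f r))" for I
  have Wp: "W I = p I" if "I \<subseteq> {1..n}" "card I = d" for I
    using W[of I] that maximal_minor_eq_sum_matchings[of I d M] finite_subset[OF that(1)]
    by (simp add: index_sets_def p_def)
  have WJ: "W (J - {i}) = p (J - {i})" if "i \<in> J" for i
    using J that fin by (intro Wp) (auto simp: index_sets_def)
  have WA: "cocircuit W A i = p (insert i A)" if "i \<in> J" "i \<notin> A" for i
    using J that fin A by (subst Wp[symmetric]) (auto simp: index_sets_def cocircuit_def)
  show "W (J - {j}) * cocircuit W A j \<preceq> (\<Sum>i\<in>J - {j}. W (J - {i}) * cocircuit W A i)"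
  proof (cases "j \<in> A")
    case True
    then show ?thesis
      by (simp add: cocircuit_def zero_dominated)
  next
    case False
    have "W (J - {j}) * cocircuit W A j = p (J - {j}) * p (insert j A)"
      using j False by (simp add: WJ WA)
    also have "\<dots> \<preceq> (\<Sum>i\<in>J - {j} - insert j A.
        p (insert j (J - {j} - {i})) * p (insert i (insert j A - {j})))"
      unfolding p_def using fin by (intro minor_product_dominated) auto
    also have "\<dots> = (\<Sum>i\<in>J - {j} - insert j A. W (J - {i}) * cocircuit W A i)"
    proof (rule sum.cong)
      fix i assume i: "i \<in> J - {j} - insert j A"
      then have "insert j (J - {j} - {i}) = J - {i}" "insert i (insert j A - {j}) = insert i A"
        using j False by auto
      then show "p (insert j (J - {j} - {i})) * p (insert i (insert j A - {j})) = W (J - {i}) * cocircuit W A i"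
        using i by (simp add: WJ WA)
    qed simp
    also have "\<dots> = (\<Sum>i\<in>J - {j}. W (J - {i}) * cocircuit W A i)"
      using fin by (intro sum.mono_neutral_left) (auto simp: cocircuit_def)
    finally show ?thesis .
  qed
qed


section \<open>Substitution into polynomials\<close>

lemma poly_mapping_eq_sum_single:
  fixes p :: "'k \<Rightarrow>\<^sub>0 'c::comm_monoid_add"
  shows "p = (\<Sum>m\<in>Poly_Mapping.keys p. Poly_Mapping.single m (Poly_Mapping.lookup p m))"
  by (rule poly_mapping_eqI)
    (auto simp: lookup_sum lookup_single when_def in_keys_iff sum.delta)

lemma poly_mapping_single_add_induct [case_names zero single add]:
  fixes p :: "'k \<Rightarrow>\<^sub>0 'c::comm_monoid_add"
  assumes "P 0" "\<And>m c. P (Poly_Mapping.single m c)" "\<And>p q. P p \<Longrightarrow> P q \<Longrightarrow> P (p + q)"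
  shows "P p"
proof -
  have "P (\<Sum>m\<in>A. Poly_Mapping.single m (Poly_Mapping.lookup p m))" for A
    by (induction A rule: infinite_finite_induct) (simp_all add: assms)
  then show ?thesis
    by (metis poly_mapping_eq_sum_single)
qed

text \<open>The homomorphism of algebras, from the free commutative algebra on the symbols \<open>gen v\<close>, that sends
  \<open>gen v\<close> to \<open>\<phi> v\<close>.\<close>

definition substitute ::
    "('v \<Rightarrow> ('m::comm_monoid_add \<Rightarrow>\<^sub>0 'a::comm_semiring_1)) \<Rightarrow> ('v multiset \<Rightarrow>\<^sub>0 'a) \<Rightarrow> ('m \<Rightarrow>\<^sub>0 'a)"
  where "substitute \<phi> p =
    (\<Sum>m\<in>Poly_Mapping.keys p. Poly_Mapping.single 0 (Poly_Mapping.lookup p m) * (\<Prod>v\<in>#m. \<phi> v))"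

lemma substitute_zero: "substitute \<phi> 0 = 0"
  by (simp add: substitute_def)

lemma substitute_single:
  "substitute \<phi> (Poly_Mapping.single m c) = Poly_Mapping.single 0 c * (\<Prod>v\<in>#m. \<phi> v)"
  by (cases "c = 0") (simp_all add: substitute_def)

lemma substitute_add: "substitute \<phi> (p + q) = substitute \<phi> p + substitute \<phi> q"
  unfolding substitute_def
  by (rule setsum_keys_plus_distrib) (simp_all add: single_add distrib_right)

lemma substitute_mult:
  fixes \<phi> :: "'a \<Rightarrow> ('b::comm_monoid_add \<Rightarrow>\<^sub>0 'c::comm_semiring_1)"
  shows "substitute \<phi> (p * q) = substitute \<phi> p * substitute \<phi> q"
proof (induction p rule: poly_mapping_single_add_induct)
  case (single m c)
  show ?case
  proof (induction q rule: poly_mapping_single_add_induct)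
    case (single m' c')
    have "substitute \<phi> (Poly_Mapping.single m c * Poly_Mapping.single m' c') =
        Poly_Mapping.single 0 (c * c') * ((\<Prod>v\<in>#m. \<phi> v) * (\<Prod>v\<in>#m'. \<phi> v))"
      by (simp add: mult_single substitute_single)
    also have "Poly_Mapping.single 0 (c * c') =
        Poly_Mapping.single 0 c * (Poly_Mapping.single 0 c' :: 'b \<Rightarrow>\<^sub>0 'c)"
      by (simp add: mult_single)
    finally show ?case
      by (simp add: substitute_single mult_ac)
  qed (simp_all add: substitute_zero substitute_add distrib_left)
qed (simp_all add: substitute_zero substitute_add distrib_right)

lemma substitute_sum: "substitute \<phi> (sum p A) = (\<Sum>i\<in>A. substitute \<phi> (p i))"
  by (induction A rule: infinite_finite_induct) (simp_all add: substitute_zero substitute_add)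

lemma substitute_one: "substitute \<phi> 1 = 1"
  using substitute_single[of \<phi> 0 1] by simp

lemma substitute_prod: "substitute \<phi> (prod p A) = (\<Prod>i\<in>A. substitute \<phi> (p i))"
  by (induction A rule: infinite_finite_induct) (simp_all add: substitute_one substitute_mult)

lemma substitute_gen: "substitute \<phi> (gen v) = \<phi> v"
  by (simp add: gen_def substitute_single)

lemma substitute_const: "substitute \<phi> (const s) = Poly_Mapping.single 0 s"
  by (simp add: const_def substitute_single)

lemma prod_single:
  "(\<Prod>i\<in>A. Poly_Mapping.single (k i) (c i)) =
    Poly_Mapping.single (\<Sum>i\<in>A. k i) (\<Prod>i\<in>A. c i :: 'a::comm_semiring_1)"
  by (induction A rule: infinite_finite_induct) (simp_all add: mult_single)


section \<open>Square-free coefficients\<close>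

text \<open>Equality in the quotient of a polynomial algebra by the squares of its variables, expressed in
  the polynomial algebra itself.\<close>

definition squarefree_equal ::
    "('b multiset \<Rightarrow>\<^sub>0 'a::comm_semiring_1) \<Rightarrow> ('b multiset \<Rightarrow>\<^sub>0 'a) \<Rightarrow> bool"
  where "squarefree_equal p q \<longleftrightarrow> (\<forall>m. (\<forall>i. count m i \<le> 1) \<longrightarrow> Poly_Mapping.lookup p m = Poly_Mapping.lookup q m)"

text \<open>A factor of a square-free monomial is square-free, so square-free coefficients of a product
  involve only square-free coefficients of the factors.\<close>

lemma squarefree_equal_mult:
  assumes "squarefree_equal p q" "squarefree_equal p' q'"
  shows "squarefree_equal (p * p') (q * q')"
  unfolding squarefree_equal_def
proof (intro allI impI)
  fix m :: "'a multiset" assume m: "\<forall>i. count m i \<le> 1"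
  have "Poly_Mapping.lookup p l * (\<Sum>k. Poly_Mapping.lookup p' k when m = l + k) =
      Poly_Mapping.lookup q l * (\<Sum>k. Poly_Mapping.lookup q' k when m = l + k)"
    for l
  proof (cases "\<exists>k. m = l + k")
    case True
    have "(Poly_Mapping.lookup p' k when m = l + k) = (Poly_Mapping.lookup q' k when m = l + k)" for k
    proof (cases "m = l + k")
      case True
      then have "\<forall>i. count k i \<le> 1"
        using m by (metis add_leE count_union)
      then show ?thesis
        using assms(2) by (simp add: squarefree_equal_def)
    qed simp
    moreover have "\<forall>i. count l i \<le> 1"
      using m True by (metis add_leE count_union)
    then have "Poly_Mapping.lookup p l = Poly_Mapping.lookup q l"
      using assms(1) by (simp add: squarefree_equal_def)
    ultimately show ?thesis
      by simp
  qed simp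
  then show "Poly_Mapping.lookup (p * p') m = Poly_Mapping.lookup (q * q') m"
    by (simp add: lookup_mult)
qed


section \<open>The tropical Grassmann algebra is free on the basis wedges\<close>

context free_semimodule
begin

abbreviation coordinate :: "nat \<Rightarrow> 'v \<Rightarrow> 'a"
  where "coordinate \<equiv> dual_basis scale n e"

abbreviation congruent :: "('a, 'v) free_algebra \<Rightarrow> ('a, 'v) free_algebra \<Rightarrow> bool" (infix "\<simeq>" 50)
  where "congruent \<equiv> algebra_congruence (grassmann_rel scale n e)"

abbreviation cl :: "('a, 'v) free_algebra \<Rightarrow> ('a, 'v) free_algebra set"
  where "cl \<equiv> grassmann_class scale n e"

lemma coordinate_outside: "i \<notin> {1..n} \<Longrightarrow> coordinate i v = 0"
  and sum_coordinates: "(\<Sum>i=1..n. coordinate i v *s e i) = v"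
  using theI'[OF basis[of v]] unfolding dual_basis_def by auto

lemma coordinate_eqI:
  assumes "\<And>k. k \<notin> {1..n} \<Longrightarrow> c k = 0" "v = (\<Sum>k=1..n. c k *s e k)"
  shows "coordinate i v = c i"
  using the1_equality[OF basis[of v], of c] assms unfolding dual_basis_def by simp

lemma coordinate_sum:
  assumes "i \<in> {1..n}"
  shows "coordinate i (\<Sum>k=1..n. c k *s e k) = c i"
  using assms by (subst coordinate_eqI[where c = "\<lambda>k. if k \<in> {1..n} then c k else 0"]) auto

lemma scale_sum: "a *s sum f A = (\<Sum>i\<in>A. a *s f i)"
  by (induction A rule: infinite_finite_induct) (simp_all add: scale_zero_right scale_add_right)

lemma coordinate_add: "coordinate i (v + w) = coordinate i v + coordinate i w"
  by (rule coordinate_eqI)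
    (simp_all add: coordinate_outside scale_add_left sum.distrib sum_coordinates del: atLeastAtMost_iff One_nat_def)

lemma coordinate_scale: "coordinate i (s *s v) = s * coordinate i v"
  by (rule coordinate_eqI)
    (simp_all add: coordinate_outside scale_sum sum_coordinates del: atLeastAtMost_iff One_nat_def
      flip: scale_scale scale_sum)

lemma coordinate_basis:
  assumes "j \<in> {1..n}"
  shows "coordinate i (e j) = (if i = j then 1 else 0)"
proof (rule coordinate_eqI)
  have "(\<Sum>k=1..n. (if k = j then 1 else 0) *s e k) = (\<Sum>k=1..n. if k = j then e k else 0)"
    by (intro sum.cong) (auto simp: scale_one scale_zero_left)
  then show "e j = (\<Sum>k=1..n. (if k = j then 1 else 0) *s e k)"
    using assms by simp
qed (use assms in auto)

text \<open>The image of a vector under the identification of V with the linear forms in n variables. Extended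
  to the free algebra by \<open>substitute\<close>, it is the model in which the coefficients of tensors are read
  off.\<close>

definition linear_form :: "'v \<Rightarrow> (nat multiset \<Rightarrow>\<^sub>0 'a)"
  where "linear_form v = (\<Sum>i=1..n. Poly_Mapping.single {#i#} (coordinate i v))"

definition coef :: "('a, 'v) free_algebra \<Rightarrow> nat set \<Rightarrow> 'a"
  where "coef p I = Poly_Mapping.lookup (substitute linear_form p) (mset_set I)"

lemma linear_form_basis: "j \<in> {1..n} \<Longrightarrow> linear_form (e j) = Poly_Mapping.single {#j#} 1"
proof -
  assume j: "j \<in> {1..n}"
  have "linear_form (e j) = (\<Sum>i=1..n. if i = j then Poly_Mapping.single {#i#} 1 else 0)"
    unfolding linear_form_def using j by (intro sum.cong) (simp_all add: coordinate_basis)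
  then show ?thesis
    using j by simp
qed

text \<open>Square-free equality is compatible with sums and products, and the images of the
  generating relations satisfy it: the linear ones become equations of polynomials, and the square of
  a variable has no square-free coefficients.\<close>

lemma congruent_imp_squarefree_equal:
  "p \<simeq> q \<Longrightarrow> squarefree_equal (substitute linear_form p) (substitute linear_form q)"
proof (induction rule: algebra_congruence.induct)
  case (base p q)
  then show ?case
  proof cases
    case (add v w)
    have "substitute linear_form p = substitute linear_form q"
      by (simp add: add substitute_gen substitute_add linear_form_def coordinate_add single_add sum.distrib)
    then show ?thesis
      by (simp add: squarefree_equal_def)
  next
    case (scale s v)
    have "substitute linear_form p = substitute linear_form q"
      by (simp add: scale substitute_gen substitute_mult substitute_const linear_form_def
          coordinate_scale sum_distrib_left mult_single)
    then show ?thesis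
      by (simp add: squarefree_equal_def)
  next
    case (square i)
    have "substitute linear_form p = Poly_Mapping.single {#i, i#} 1"
      using square by (simp add: power2_eq_square substitute_gen substitute_mult linear_form_basis mult_single)
    moreover have "count {#i, i#} i > 1"
      by simp
    ultimately show ?thesis
      unfolding squarefree_equal_def square(2) substitute_zero
      by (metis lookup_single_not_eq lookup_zero not_less)
  qed
next
  case (mult p q p' q')
  then show ?case
    by (simp add: substitute_mult squarefree_equal_mult)
qed (simp_all add: squarefree_equal_def substitute_add lookup_add)

lemma congruent_imp_coef_eq:
  assumes "p \<simeq> q"
  shows "coef p I = coef q I"
  using congruent_imp_squarefree_equal[OF assms]
  by (simp add: squarefree_equal_def coef_def count_mset_set')

declare algebra_congruence.trans [trans]

lemma gen_zero: "gen 0 \<simeq> 0"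
  using algebra_congruence.base[of "grassmann_rel scale n e", OF grassmann_rel.scale[of scale n e 0 0]]
  by (simp add: scale_zero_left const_def)

lemma gen_expansion: "gen v \<simeq> (\<Sum>i=1..n. const (coordinate i v) * gen (e i))"
proof -
  have "gen (\<Sum>i\<in>A. c i *s e i) \<simeq> (\<Sum>i\<in>A. const (c i) * gen (e i))" if "finite A" for A c
    using that
  proof (induction A rule: finite_induct)
    case (insert i A)
    have "gen (c i *s e i + (\<Sum>i\<in>A. c i *s e i)) \<simeq> gen (c i *s e i) + gen (\<Sum>i\<in>A. c i *s e i)"
      by (intro algebra_congruence.base grassmann_rel.add)
    also have "\<dots> \<simeq> const (c i) * gen (e i) + (\<Sum>i\<in>A. const (c i) * gen (e i))"
      by (intro algebra_congruence.add insert.IH algebra_congruence.base grassmann_rel.scale)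
    finally show ?case
      using insert.hyps by simp
  qed (simp add: gen_zero)
  from this[of "{1..n}" "\<lambda>i. coordinate i v"] show ?thesis
    by (simp add: sum_coordinates del: One_nat_def)
qed

definition monom :: "nat set \<Rightarrow> ('a, 'v) free_algebra"
  where "monom K = (\<Prod>i\<in>K. gen (e i))"

lemma substitute_monom:
  assumes "K \<subseteq> {1..n}"
  shows "substitute linear_form (monom K) = Poly_Mapping.single (mset_set K) 1"
proof -
  have "finite K"
    using assms by (rule finite_subset) simp
  have "substitute linear_form (monom K) = (\<Prod>i\<in>K. Poly_Mapping.single {#i#} 1)"
    unfolding monom_def substitute_prod
    using assms by (intro prod.cong) (auto simp: substitute_gen linear_form_basis)
  also have "\<dots> = Poly_Mapping.single (\<Sum>i\<in>K. {#i#}) 1"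
    by (simp add: prod_single)
  also have "(\<Sum>i\<in>K. {#i#}) = mset_set K"
    using \<open>finite K\<close> by (induction K rule: finite_induct) auto
  finally show ?thesis .
qed

lemma gen_mult_monom:
  assumes "i \<in> {1..n}" "finite K"
  shows "gen (e i) * monom K \<simeq> (if i \<in> K then 0 else monom (insert i K))"
proof (cases "i \<in> K")
  case True
  have "gen (e i) * monom K = gen (e i) ^ 2 * monom (K - {i})"
    using True assms(2) by (simp add: monom_def prod.remove[of K i] power2_eq_square mult.assoc)
  also have "\<dots> \<simeq> 0 * monom (K - {i})"
    using assms(1)
    by (intro algebra_congruence.mult algebra_congruence.refl algebra_congruence.base grassmann_rel.square)
  finally show ?thesis
    using True by simp
qed (use assms in \<open>simp add: monom_def algebra_congruence.refl\<close>)

definition combination :: "nat \<Rightarrow> (nat set \<Rightarrow> 'a) \<Rightarrow> ('a, 'v) free_algebra"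
  where "combination d w = (\<Sum>K\<in>index_sets n d. const (w K) * monom K)"

text \<open>This gives linear independence of the basis wedges, because \<open>coef\<close> is invariant under the
  congruence.\<close>

lemma coef_combination:
  assumes "I \<in> index_sets n d"
  shows "coef (combination d w) I = w I"
proof -
  have "substitute linear_form (combination d w) =
      (\<Sum>K\<in>index_sets n d. Poly_Mapping.single (mset_set K) (w K))"
    unfolding combination_def substitute_sum
    by (intro sum.cong) (auto simp: substitute_mult substitute_const substitute_monom index_sets_def mult_single)
  then have "coef (combination d w) I = (\<Sum>K\<in>index_sets n d. w K when mset_set K = mset_set I)"
    by (simp add: coef_def lookup_sum lookup_single)
  also have "\<dots> = (\<Sum>K\<in>index_sets n d. if K = I then w K else 0)"
    using assms by (intro sum.cong) (auto simp: when_def finite_index_set dest: mset_set_eq_iff[THEN iffD1, rotated 2])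
  finally show ?thesis
    using assms by (simp add: finite_index_sets)
qed

definition spanned :: "nat \<Rightarrow> ('a, 'v) free_algebra \<Rightarrow> bool"
  where "spanned d p \<longleftrightarrow> (\<exists>w. p \<simeq> combination d w)"

lemma spanned_congruent: "p \<simeq> q \<Longrightarrow> spanned d q \<Longrightarrow> spanned d p"
  unfolding spanned_def by (blast intro: algebra_congruence.trans)

lemma const_add: "const (a + b) = const a + const b"
  and const_mult: "const (a * b) = const a * const b"
  and const_zero: "const 0 = 0"
  and const_one: "const 1 = 1"
  by (simp_all add: const_def single_add mult_single)

lemma spanned_zero: "spanned d 0"
  unfolding spanned_def combination_def
  by (rule exI[of _ "\<lambda>_. 0"]) (simp add: const_zero algebra_congruence.refl)

lemma spanned_add: "spanned d p \<Longrightarrow> spanned d q \<Longrightarrow> spanned d (p + q)"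
proof -
  have "combination d w + combination d w' = combination d (\<lambda>K. w K + w' K)" for w w'
    by (simp add: combination_def const_add distrib_right sum.distrib)
  then show "spanned d p \<Longrightarrow> spanned d q \<Longrightarrow> spanned d (p + q)"
    unfolding spanned_def by (metis algebra_congruence.add)
qed

lemma spanned_sum: "(\<And>i. i \<in> A \<Longrightarrow> spanned d (p i)) \<Longrightarrow> spanned d (sum p A)"
  by (induction A rule: infinite_finite_induct) (simp_all add: spanned_zero spanned_add)

lemma spanned_const_mult: "spanned d p \<Longrightarrow> spanned d (const s * p)"
proof -
  have "const s * combination d w = combination d (\<lambda>K. s * w K)" for w
    by (simp add: combination_def const_mult sum_distrib_left mult.assoc)
  then show "spanned d p \<Longrightarrow> spanned d (const s * p)"
    unfolding spanned_def by (metis algebra_congruence.mult algebra_congruence.refl)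
qed

lemma spanned_monom:
  assumes "K \<in> index_sets n d"
  shows "spanned d (monom K)"
proof -
  have "combination d (\<lambda>L. if L = K then 1 else 0) = (\<Sum>L\<in>index_sets n d. if L = K then monom L else 0)"
    unfolding combination_def by (intro sum.cong) (simp_all add: const_zero const_one)
  then have "combination d (\<lambda>L. if L = K then 1 else 0) = monom K"
    using assms by (simp add: finite_index_sets)
  then show ?thesis
    unfolding spanned_def by (metis algebra_congruence.refl)
qed

text \<open>Expand the vector in the basis. A product of a basis vector with a basis wedge is zero when
  the vector already occurs in it, and another basis wedge otherwise.\<close>

lemma spanned_gen_mult:
  assumes "spanned d p"
  shows "spanned (d + 1) (gen v * p)"
proof -
  obtain w where w: "p \<simeq> combination d w"
    using assms by (auto simp: spanned_def)
  have mon: "spanned (d + 1) (gen (e i) * monom K)" if "i \<in> {1..n}" "K \<in> index_sets n d" for i K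
    using gen_mult_monom[OF that(1) finite_index_set[OF that(2)]] that insert_index_set[OF that(2,1)]
    by (cases "i \<in> K") (auto intro: spanned_congruent spanned_zero spanned_monom)
  have "gen v * p \<simeq> (\<Sum>i=1..n. const (coordinate i v) * gen (e i)) * combination d w"
    using gen_expansion w by (rule algebra_congruence.mult)
  also have "\<dots> = (\<Sum>i=1..n. \<Sum>K\<in>index_sets n d.
      const (coordinate i v) * (const (w K) * (gen (e i) * monom K)))"
    unfolding combination_def sum_product by (intro sum.cong) (simp_all add: mult_ac)
  finally show ?thesis
    by (rule spanned_congruent) (intro spanned_sum spanned_const_mult mon)
qed

lemma spanned_homogeneous:
  assumes "\<forall>m\<in>Poly_Mapping.keys p. size m = d"
  shows "spanned d p"
proof -
  have monomial: "spanned (size m) (Poly_Mapping.single m 1)" for m :: "'v multiset"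
  proof (induction m)
    case empty
    have "spanned 0 (monom {})"
      by (intro spanned_monom) (simp add: index_sets_def)
    then show ?case
      by (simp add: monom_def flip: zero_multiset_def)
  next
    case (add v m)
    have "Poly_Mapping.single (add_mset v m) (1 :: 'a) = gen v * Poly_Mapping.single m 1"
      by (simp add: gen_def mult_single)
    then show ?case
      using spanned_gen_mult[OF add.IH, of v] by simp
  qed
  have "p = (\<Sum>m\<in>Poly_Mapping.keys p. const (Poly_Mapping.lookup p m) * Poly_Mapping.single m 1)"
    using poly_mapping_eq_sum_single[of p] by (simp add: const_def mult_single)
  moreover have "spanned d (\<Sum>m\<in>Poly_Mapping.keys p. const (Poly_Mapping.lookup p m) * Poly_Mapping.single m 1)"
    using assms monomial by (intro spanned_sum spanned_const_mult) metis
  ultimately show ?thesis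
    by simp
qed

text \<open>The coefficients of a spanning combination are forced, since \<open>coef\<close> recovers them.\<close>

lemma homogeneous_congruent_combination:
  assumes "\<forall>m\<in>Poly_Mapping.keys p. size m = d"
  shows "p \<simeq> combination d (coef p)"
proof -
  obtain w where w: "p \<simeq> combination d w"
    using spanned_homogeneous[OF assms] by (auto simp: spanned_def)
  have "combination d w = combination d (coef p)"
    unfolding combination_def
    by (intro sum.cong) (simp_all add: congruent_imp_coef_eq[OF w] coef_combination)
  then show ?thesis
    using w by simp
qed

abbreviation G where "G \<equiv> grassmann scale n e"

lemma carrier_grassmann: "carrier G = range cl"
  and one_grassmann: "\<one>\<^bsub>G\<^esub> = cl 1"
  and zero_grassmann: "\<zero>\<^bsub>G\<^esub> = cl 0"
  by (simp_all add: grassmann_def Let_def)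

lemma comm_monoid_grassmann: "comm_monoid G"
  by (rule comm_monoidI)
    (auto simp: carrier_grassmann one_grassmann grassmann_mult mult_ac)

lemma abelian_monoid_grassmann: "abelian_monoid G"
  by (rule abelian_monoidI)
    (auto simp: carrier_grassmann zero_grassmann grassmann_add add_ac)

lemma finprod_class: "finite A \<Longrightarrow> (\<Otimes>\<^bsub>G\<^esub>i\<in>A. cl (p i)) = cl (\<Prod>i\<in>A. p i)"
proof (induction A rule: finite_induct)
  case empty
  then show ?case
    by (simp add: comm_monoid.finprod_empty[OF comm_monoid_grassmann] one_grassmann)
next
  case (insert i A)
  then show ?case
    by (subst comm_monoid.finprod_insert[OF comm_monoid_grassmann])
      (auto simp: carrier_grassmann grassmann_mult)
qed

lemma finsum_class: "finite A \<Longrightarrow> (\<Oplus>\<^bsub>G\<^esub>i\<in>A. cl (p i)) = cl (\<Sum>i\<in>A. p i)"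
proof (induction A rule: finite_induct)
  case empty
  then show ?case
    by (simp add: abelian_monoid.finsum_empty[OF abelian_monoid_grassmann] zero_grassmann)
next
  case (insert i A)
  then show ?case
    by (subst abelian_monoid.finsum_insert[OF abelian_monoid_grassmann])
      (auto simp: carrier_grassmann grassmann_add)
qed

lemma basis_wedge_class: "finite K \<Longrightarrow> basis_wedge scale n e K = cl (monom K)"
  by (simp add: basis_wedge_def grassmann_vec_def finprod_class monom_def)

lemma finsum_basis_wedges:
  "(\<Oplus>\<^bsub>G\<^esub>K\<in>index_sets n d. w K \<odot>\<^bsub>G\<^esub> basis_wedge scale n e K) = cl (combination d w)"
proof -
  have "(\<Oplus>\<^bsub>G\<^esub>K\<in>index_sets n d. w K \<odot>\<^bsub>G\<^esub> basis_wedge scale n e K) =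
      (\<Oplus>\<^bsub>G\<^esub>K\<in>index_sets n d. cl (const (w K) * monom K))"
    by (intro abelian_monoid.finsum_cong'[OF abelian_monoid_grassmann])
      (auto simp: carrier_grassmann basis_wedge_class finite_index_set grassmann_smult)
  then show ?thesis
    by (simp add: finsum_class finite_index_sets combination_def)
qed

abbreviation coord :: "nat \<Rightarrow> ('a, 'v) free_algebra set \<Rightarrow> nat set \<Rightarrow> 'a"
  where "coord \<equiv> grassmann_coord scale n e"

abbreviation degree_part :: "nat \<Rightarrow> ('a, 'v) free_algebra set set"
  where "degree_part \<equiv> grassmann_deg scale n e"

text \<open>The expansion of a homogeneous element in the basis wedges exists and is unique, so the definite
  description in \<open>grassmann_coord\<close> denotes the square-free coefficients, extended by zero to sets that
  do not index a basis wedge.\<close>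

lemma degree_part_eq_combination:
  assumes "\<omega> \<in> degree_part d"
  shows "\<omega> = cl (combination d (coord d \<omega>))"
    and "\<And>p I. cl p = \<omega> \<Longrightarrow> I \<in> index_sets n d \<Longrightarrow> coord d \<omega> I = coef p I"
proof -
  obtain q where q: "\<omega> = cl q" "\<forall>m\<in>Poly_Mapping.keys q. size m = d"
    using assms by (auto simp: grassmann_deg_def)
  define c where "c I = (if I \<in> index_sets n d then coef q I else 0)" for I
  have "combination d c = combination d (coef q)"
    unfolding combination_def by (intro sum.cong) (simp_all add: c_def)
  then have c: "\<omega> = cl (combination d c)"
    using homogeneous_congruent_combination[OF q(2)] q(1) by (simp add: grassmann_class_eq_iff)
  have "coord d \<omega> = c"
    unfolding grassmann_coord_def finsum_basis_wedges
  proof (rule the_equality, intro conjI allI impI)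
    fix w assume w: "(\<forall>K. K \<notin> index_sets n d \<longrightarrow> w K = 0) \<and> \<omega> = cl (combination d w)"
    then have "q \<simeq> combination d w"
      using q(1) by (simp add: grassmann_class_eq_iff)
    then have "coef q I = w I" if "I \<in> index_sets n d" for I
      using coef_combination[OF that] by (simp add: congruent_imp_coef_eq)
    then show "w = c"
      using w by (auto simp: c_def)
  qed (use c in \<open>auto simp: c_def\<close>)
  then show "\<omega> = cl (combination d (coord d \<omega>))"
    using c by simp
  show "coord d \<omega> I = coef p I" if "cl p = \<omega>" "I \<in> index_sets n d" for p I
    using that \<open>coord d \<omega> = c\<close> q(1) by (simp add: c_def grassmann_class_eq_iff congruent_imp_coef_eq)
qed

lemma degree_part_eqI:
  assumes "\<omega> \<in> degree_part d" "\<omega>' \<in> degree_part d"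
    and "\<And>I. I \<in> index_sets n d \<Longrightarrow> coord d \<omega> I = coord d \<omega>' I"
  shows "\<omega> = \<omega>'"
proof -
  have "combination d (coord d \<omega>) = combination d (coord d \<omega>')"
    unfolding combination_def using assms(3) by (intro sum.cong) simp_all
  then show ?thesis
    using degree_part_eq_combination(1)[OF assms(1)] degree_part_eq_combination(1)[OF assms(2)] by simp
qed

lemma zero_in_degree_part: "\<zero>\<^bsub>G\<^esub> \<in> degree_part d"
  by (auto simp: grassmann_deg_def zero_grassmann)

lemma coord_zero: "I \<in> index_sets n d \<Longrightarrow> coord d \<zero>\<^bsub>G\<^esub> I = 0"
  using degree_part_eq_combination(2)[OF zero_in_degree_part, of 0 I]
  by (simp add: zero_grassmann coef_def substitute_zero)

lemma degree_part_zero_iff: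
  assumes "\<omega> \<in> degree_part d"
  shows "\<omega> = \<zero>\<^bsub>G\<^esub> \<longleftrightarrow> (\<forall>I\<in>index_sets n d. coord d \<omega> I = 0)"
  using degree_part_eqI[OF assms zero_in_degree_part] coord_zero by auto

lemma smult_in_degree_part:
  assumes "\<omega> \<in> degree_part d"
  shows "s \<odot>\<^bsub>G\<^esub> \<omega> \<in> degree_part d"
proof -
  obtain q where q: "\<omega> = cl q" "\<forall>m\<in>Poly_Mapping.keys q. size m = d"
    using assms by (auto simp: grassmann_deg_def)
  have "\<forall>m\<in>Poly_Mapping.keys (const s * q). size m = d"
    using keys_mult[of "const s" q] q(2) by (fastforce simp: const_def split: if_splits)
  then show ?thesis
    unfolding q(1) grassmann_smult by (auto simp: grassmann_deg_def)
qed

lemma coord_smult: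
  assumes "\<omega> \<in> degree_part d" "I \<in> index_sets n d"
  shows "coord d (s \<odot>\<^bsub>G\<^esub> \<omega>) I = s * coord d \<omega> I"
proof -
  obtain q where q: "\<omega> = cl q"
    using assms(1) by (auto simp: grassmann_deg_def)
  have "coord d (s \<odot>\<^bsub>G\<^esub> \<omega>) I = coef (const s * q) I"
    using smult_in_degree_part[OF assms(1)] assms(2)
    by (intro degree_part_eq_combination(2)) (simp_all add: q grassmann_smult)
  also have "\<dots> = s * coef q I"
    by (simp add: coef_def substitute_mult substitute_const flip: mult_map_scale_conv_mult)
      (simp add: Poly_Mapping.map.rep_eq when_def)
  finally show ?thesis
    using degree_part_eq_combination(2)[OF assms(1) _ assms(2), of q] q by simp
qed


section \<open>Wedge products of vectors\<close>

lemma wedge_class: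
  fixes d :: nat
  shows "(\<Otimes>\<^bsub>G\<^esub>i\<in>{1..d}. grassmann_vec scale n e (v i)) = cl (\<Prod>i=1..d. gen (v i))"
  by (simp add: grassmann_vec_def finprod_class)

lemma wedge_in_degree_part: "cl (\<Prod>i=1..d. gen (v i)) \<in> degree_part d"
proof -
  have "(\<Prod>i=1..d. gen (v i)) = Poly_Mapping.single (\<Sum>i=1..d. {#v i#}) (1 :: 'a)"
    unfolding gen_def by (simp add: prod_single)
  moreover have "size (\<Sum>i\<in>A. {#v i#}) = card A" for A
    by (induction A rule: infinite_finite_induct) simp_all
  ultimately show ?thesis
    by (auto simp: grassmann_deg_def)
qed

text \<open>Expanding the product of the linear forms gives one monomial for each function \<open>g\<close> from the factors
  to the variables. It is the monomial of \<open>I\<close> exactly when the image of \<open>g\<close> is \<open>I\<close>, and then \<open>g\<close> is bijective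
  because the d factors are as many as the elements of \<open>I\<close>. What remains is the sum over matchings.\<close>

lemma coord_wedge:
  assumes I: "I \<in> index_sets n d"
  shows "coord d (cl (\<Prod>i=1..d. gen (v i))) I = maximal_minor d (\<lambda>i j. coordinate j (v i)) I"
proof -
  let ?D = "{1..d}" and ?P = "\<lambda>g. \<Prod>i=1..d. coordinate (g i) (v i)"
  have match: "(\<Sum>i\<in>?D. {#g i#}) = mset_set I \<longleftrightarrow> g \<in> matchings ?D I" if g: "g \<in> ?D \<rightarrow>\<^sub>E {1..n}" for g
  proof -
    have im: "(\<Sum>i\<in>A. {#g i#}) = image_mset g (mset_set A)" if "finite A" for A
      using that by (induction A rule: finite_induct) simp_all
    show ?thesis
    proof
      assume "(\<Sum>i\<in>?D. {#g i#}) = mset_set I"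
      then have "image_mset g (mset_set ?D) = mset_set I"
        by (simp only: im finite_atLeastAtMost)
      then have "set_mset (image_mset g (mset_set ?D)) = set_mset (mset_set I)"
        by (rule arg_cong)
      then have "g ` ?D = I"
        using finite_index_set[OF I] by simp
      moreover from this have "inj_on g ?D"
        using I by (intro eq_card_imp_inj_on) (auto simp: index_sets_def)
      ultimately show "g \<in> matchings ?D I"
        using g by (intro matchingsI) (auto simp: bij_betw_def PiE_def)
    next
      assume "g \<in> matchings ?D I"
      then have "inj_on g ?D" "g ` ?D = I"
        by (auto simp: matchings_def bij_betw_def)
      then show "(\<Sum>i\<in>?D. {#g i#}) = mset_set I"
        by (simp only: im finite_atLeastAtMost image_mset_mset_set)
    qed
  qed
  have "substitute linear_form (\<Prod>i\<in>?D. gen (v i)) = (\<Prod>i\<in>?D. linear_form (v i))"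
    by (simp add: substitute_prod substitute_gen)
  also have "\<dots> = (\<Sum>g\<in>?D \<rightarrow>\<^sub>E {1..n}. \<Prod>i\<in>?D. Poly_Mapping.single {#g i#} (coordinate (g i) (v i)))"
    unfolding linear_form_def by (rule prod_sum_PiE) simp_all
  also have "\<dots> = (\<Sum>g\<in>?D \<rightarrow>\<^sub>E {1..n}. Poly_Mapping.single (\<Sum>i\<in>?D. {#g i#}) (?P g))"
    by (simp only: prod_single)
  finally have "coef (\<Prod>i\<in>?D. gen (v i)) I =
      (\<Sum>g\<in>?D \<rightarrow>\<^sub>E {1..n}. ?P g when (\<Sum>i\<in>?D. {#g i#}) = mset_set I)"
    by (simp only: coef_def lookup_sum lookup_single)
  also have "\<dots> = (\<Sum>g\<in>?D \<rightarrow>\<^sub>E {1..n}. if g \<in> matchings ?D I then ?P g else 0)"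
    by (intro sum.cong) (simp_all only: match when_def)
  also have "\<dots> = (\<Sum>g\<in>matchings ?D I. ?P g)"
  proof -
    have "matchings ?D I \<subseteq> ?D \<rightarrow>\<^sub>E {1..n}"
      using I by (auto simp: matchings_def index_sets_def PiE_def)
    then show ?thesis
      by (simp add: finite_PiE Int_absorb1 flip: sum.inter_restrict del: One_nat_def)
  qed
  also have "\<dots> = maximal_minor d (\<lambda>i j. coordinate j (v i)) I"
    using I finite_index_set[OF I] by (subst maximal_minor_eq_sum_matchings) (auto simp: index_sets_def)
  finally show ?thesis
    using degree_part_eq_combination(2)[OF wedge_in_degree_part _ I] by simp
qed

lemma maximal_minor_cong:
  assumes "I \<in> index_sets n d"
    and "\<And>i j. i \<in> {1..d} \<Longrightarrow> j \<in> {1..n} \<Longrightarrow> M i j = M' i j"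
  shows "maximal_minor d M I = maximal_minor d M' I"
proof -
  have I: "finite I" "card I = d" "I \<subseteq> {1..n}"
    using assms(1) finite_index_set[OF assms(1)] by (auto simp: index_sets_def)
  show ?thesis
    unfolding maximal_minor_eq_sum_matchings[OF I(1,2)]
  proof (intro sum.cong prod.cong HOL.refl)
    fix f i assume "f \<in> matchings {1..d} I" "i \<in> {1..d}"
    moreover from this have "bij_betw f {1..d} I"
      by (simp add: matchings_def)
    then have "f i \<in> I"
      using \<open>i \<in> {1..d}\<close> by (rule bij_betwE[rule_format])
    ultimately have "i \<in> {1..d}" "f i \<in> {1..n}"
      using I(3) by blast+
    then show "M i (f i) = M' i (f i)"
      by (rule assms(2))
  qed
qed

text \<open>The rows of the matrix are the coordinate vectors of the factors.\<close>

theorem totally_decomposable_iff_maximal_minors: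
  assumes "\<omega> \<in> degree_part d"
  shows "totally_decomposable scale n e d \<omega> \<longleftrightarrow>
    (\<exists>M. \<forall>I\<in>index_sets n d. coord d \<omega> I = maximal_minor d M I)"
proof
  assume "totally_decomposable scale n e d \<omega>"
  then obtain v where "\<omega> = cl (\<Prod>i=1..d. gen (v i))"
    by (auto simp: totally_decomposable_def wedge_class simp del: One_nat_def)
  then show "\<exists>M. \<forall>I\<in>index_sets n d. coord d \<omega> I = maximal_minor d M I"
    using coord_wedge by blast
next
  assume "\<exists>M. \<forall>I\<in>index_sets n d. coord d \<omega> I = maximal_minor d M I"
  then obtain M where M: "\<And>I. I \<in> index_sets n d \<Longrightarrow> coord d \<omega> I = maximal_minor d M I"
    by blast
  define v where "v i = (\<Sum>j=1..n. M i j *s e j)" for i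
  have "\<omega> = cl (\<Prod>i=1..d. gen (v i))"
  proof (rule degree_part_eqI[OF assms wedge_in_degree_part])
    fix I assume I: "I \<in> index_sets n d"
    show "coord d \<omega> I = coord d (cl (\<Prod>i=1..d. gen (v i))) I"
      unfolding coord_wedge[OF I] M[OF I]
      using I by (rule maximal_minor_cong) (simp only: v_def coordinate_sum)
  qed
  then show "totally_decomposable scale n e d \<omega>"
    by (auto simp: totally_decomposable_def wedge_class simp del: One_nat_def)
qed


section \<open>The linear space of a tensor\<close>

abbreviation L where "L \<equiv> L_space scale n e"

text \<open>Dropping an index outside \<open>J\<close> changes nothing, so only the conditions for indices in \<open>J\<close> remain.
  Each of them says that the dropped term is dominated by the others.\<close>

lemma mem_tropical_hyperplane_iff:
  fixes c :: "nat \<Rightarrow> 'a"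
  assumes J: "J \<subseteq> {1..n}"
  shows "v \<in> tropical_hyperplane scale n e (\<lambda>x. \<Sum>i\<in>J. c i * coordinate i x) \<longleftrightarrow>
    (\<forall>j\<in>J. c j * coordinate j v \<preceq> (\<Sum>i\<in>J - {j}. c i * coordinate i v))"
proof -
  have fin: "finite J"
    using J by (rule finite_subset) simp
  have coeff: "(\<Sum>k\<in>J. c k * coordinate k (e i)) = (if i \<in> J then c i else 0)" if "i \<in> {1..n}" for i
  proof -
    have "(\<Sum>k\<in>J. c k * coordinate k (e i)) = (\<Sum>k\<in>J. if k = i then c k else 0)"
      using that by (intro sum.cong) (simp_all add: coordinate_basis)
    then show ?thesis
      using fin by simp
  qed
  have part: "(\<Sum>i\<in>A. (\<Sum>k\<in>J. c k * coordinate k (e i)) * coordinate i v) =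
      (\<Sum>i\<in>A \<inter> J. c i * coordinate i v)" if "A \<subseteq> {1..n}" for A
  proof -
    have "(\<Sum>i\<in>A. (\<Sum>k\<in>J. c k * coordinate k (e i)) * coordinate i v) =
        (\<Sum>i\<in>A. if i \<in> J then c i * coordinate i v else 0)"
      using that by (intro sum.cong) (auto simp: coeff)
    then show ?thesis
      using that by (simp add: sum.inter_restrict finite_subset)
  qed
  have "v \<in> tropical_hyperplane scale n e (\<lambda>x. \<Sum>i\<in>J. c i * coordinate i x) \<longleftrightarrow>
      (\<forall>j\<in>{1..n}. (\<Sum>i\<in>{1..n} \<inter> J. c i * coordinate i v) =
        (\<Sum>i\<in>({1..n} - {j}) \<inter> J. c i * coordinate i v))"
    by (simp add: tropical_hyperplane_def part del: One_nat_def)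
  also have "\<dots> \<longleftrightarrow> (\<forall>j\<in>{1..n}. (\<Sum>i\<in>J. c i * coordinate i v) = (\<Sum>i\<in>J - {j}. c i * coordinate i v))"
  proof -
    have "{1..n} \<inter> J = J" "({1..n} - {j}) \<inter> J = J - {j}" for j
      using J by auto
    then show ?thesis
      by simp
  qed
  also have "\<dots> \<longleftrightarrow> (\<forall>j\<in>J. (\<Sum>i\<in>J. c i * coordinate i v) = (\<Sum>i\<in>J - {j}. c i * coordinate i v))"
    using J by (metis Diff_empty Diff_insert0 subsetD)
  also have "\<dots> \<longleftrightarrow> (\<forall>j\<in>J. c j * coordinate j v \<preceq> (\<Sum>i\<in>J - {j}. c i * coordinate i v))"
    by (intro ball_cong) (simp_all add: sum.remove[OF fin] dominated_def)
  finally show ?thesis .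
qed

lemma mem_L_iff: "v \<in> L d \<omega> \<longleftrightarrow> (\<lambda>i. coordinate i v) \<in> tropical_solutions n d (coord d \<omega>)"
proof -
  have "J \<subseteq> {1..n}" if "J \<in> index_sets n (d + 1)" for J
    using that by (auto simp: index_sets_def)
  then show ?thesis
    by (simp add: L_space_def tropical_solutions_def mem_tropical_hyperplane_iff)
qed

text \<open>The two solution sets also contain functions with nonzero values outside \<open>{1..n}\<close>, which are not
  coordinate vectors. Such values do not enter the equations, so they may be changed to zero.\<close>

lemma L_determines_solutions:
  assumes "L d \<omega> = L d \<omega>'"
  shows "tropical_solutions n d (coord d \<omega>) = tropical_solutions n d (coord d \<omega>')"
proof -
  have "y \<in> tropical_solutions n d W \<longleftrightarrow>
      (\<lambda>i. coordinate i (\<Sum>i=1..n. y i *s e i)) \<in> tropical_solutions n d W"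
    for y and W :: "nat set \<Rightarrow> 'a"
  proof -
    have eq: "coordinate i (\<Sum>i=1..n. y i *s e i) = y i" if "i \<in> J" "J \<in> index_sets n (d + 1)" for i J
      using that by (intro coordinate_sum) (auto simp: index_sets_def)
    show ?thesis
      unfolding tropical_solutions_def mem_Collect_eq
      by (intro ball_cong sum.cong HOL.refl arg_cong2[where f = dominated] arg_cong2[where f = times])
        (auto intro: eq[symmetric] simp del: One_nat_def)
  qed
  then show ?thesis
    using assms mem_L_iff by blast
qed

lemma L_smult:
  assumes "\<omega> \<in> degree_part d" "s \<noteq> 0"
  shows "L d (s \<odot>\<^bsub>G\<^esub> \<omega>) = L d \<omega>"
proof -
  have [simp]: "s * a \<preceq> s * b \<longleftrightarrow> a \<preceq> b" for a b
    using semifield_mult_cancel[OF assms(2)] by (auto simp: dominated_def simp flip: distrib_left)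
  have coord: "coord d (s \<odot>\<^bsub>G\<^esub> \<omega>) (J - {j}) = s * coord d \<omega> (J - {j})"
    if "j \<in> J" "J \<in> index_sets n (d + 1)" for j J
    using that finite_index_set[OF that(2)]
    by (intro coord_smult[OF assms(1)]) (auto simp: index_sets_def)
  have "y \<in> tropical_solutions n d (coord d (s \<odot>\<^bsub>G\<^esub> \<omega>)) \<longleftrightarrow> y \<in> tropical_solutions n d (coord d \<omega>)"
    for y
    unfolding tropical_solutions_def mem_Collect_eq
    by (intro ball_cong) (simp_all add: coord mult.assoc flip: sum_distrib_left)
  then show ?thesis
    by (auto simp: mem_L_iff)
qed

lemma mem_proj_class: "\<omega> \<in> degree_part d \<Longrightarrow> \<omega> \<in> proj_class scale n e \<omega>"
  unfolding proj_class_def grassmann_deg_def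
  by (auto simp: grassmann_smult const_one intro!: exI[of _ 1])

lemma L_class_proj_class:
  assumes "\<omega> \<in> degree_part d"
  shows "L_class scale n e d (proj_class scale n e \<omega>) = L d \<omega>"
proof -
  have "L d ` proj_class scale n e \<omega> = {L d \<omega>}"
  proof
    show "L d ` proj_class scale n e \<omega> \<subseteq> {L d \<omega>}"
      by (auto simp: proj_class_def L_smult[OF assms])
    show "{L d \<omega>} \<subseteq> L d ` proj_class scale n e \<omega>"
      using mem_proj_class[OF assms] by blast
  qed
  then show ?thesis
    by (simp add: L_class_def)
qed

lemma proj_class_smult:
  assumes "\<omega> \<in> degree_part d" "s \<noteq> 0"
  shows "proj_class scale n e (s \<odot>\<^bsub>G\<^esub> \<omega>) = proj_class scale n e \<omega>"
proof -
  obtain p where p: "\<omega> = cl p"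
    using assms(1) by (auto simp: grassmann_deg_def)
  have ss: "t \<odot>\<^bsub>G\<^esub> (s \<odot>\<^bsub>G\<^esub> \<omega>) = (t * s) \<odot>\<^bsub>G\<^esub> \<omega>" for t s
    by (simp add: p grassmann_smult const_mult mult.assoc)
  obtain r where r: "s * r = 1"
    using ex_inverse[OF assms(2)] by blast
  have "t \<odot>\<^bsub>G\<^esub> \<omega> = (t * r) \<odot>\<^bsub>G\<^esub> (s \<odot>\<^bsub>G\<^esub> \<omega>)" for t
    using r by (simp add: ss mult.assoc mult.commute[of r s])
  moreover have "r \<noteq> 0"
    using r by auto
  ultimately show ?thesis
    using assms(2) unfolding proj_class_def
    by (auto simp: ss) (metis semifield_no_zero_divisors)+
qed

text \<open>Both sides of the bijection are images of this set of tensors.\<close>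

definition decomposables :: "nat \<Rightarrow> ('a, 'v) free_algebra set set"
  where "decomposables d =
    {\<omega> \<in> degree_part d. totally_decomposable scale n e d \<omega> \<and> \<omega> \<noteq> \<zero>\<^bsub>G\<^esub>}"

lemma totally_decomposable_locus_eq:
  "totally_decomposable_locus scale n e d = proj_class scale n e ` decomposables d"
proof
  show "proj_class scale n e ` decomposables d \<subseteq> totally_decomposable_locus scale n e d"
    by (auto simp: decomposables_def totally_decomposable_locus_def proj_space_def intro: mem_proj_class)
  show "totally_decomposable_locus scale n e d \<subseteq> proj_class scale n e ` decomposables d"
  proof
    fix c assume "c \<in> totally_decomposable_locus scale n e d"
    then obtain \<omega> \<omega>' where c: "c = proj_class scale n e \<omega>" and \<omega>: "\<omega> \<in> degree_part d" "\<omega> \<noteq> \<zero>\<^bsub>G\<^esub>"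
      and \<omega>': "\<omega>' \<in> c" "totally_decomposable scale n e d \<omega>'"
      by (auto simp: totally_decomposable_locus_def proj_space_def)
    then obtain s where s: "s \<noteq> 0" "\<omega>' = s \<odot>\<^bsub>G\<^esub> \<omega>"
      by (auto simp: proj_class_def)
    have "\<omega>' \<noteq> \<zero>\<^bsub>G\<^esub>"
      using \<omega> s degree_part_zero_iff[OF \<omega>(1)] degree_part_zero_iff[OF smult_in_degree_part[OF \<omega>(1)]]
      by (auto simp: coord_smult semifield_no_zero_divisors)
    then have "\<omega>' \<in> decomposables d"
      using \<omega> \<omega>' s smult_in_degree_part by (simp add: decomposables_def)
    moreover have "c = proj_class scale n e \<omega>'"
      using c s proj_class_smult[OF \<omega>(1)] by simp
    ultimately show "c \<in> proj_class scale n e ` decomposables d"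
      by blast
  qed
qed

lemma stiefel_spaces_eq: "stiefel_spaces scale n e d = L d ` decomposables d"
proof -
  have "(\<exists>M. (\<forall>I\<in>index_sets n d. coord d \<omega> I = maximal_minor d M I) \<and>
      (\<exists>I\<in>index_sets n d. maximal_minor d M I \<noteq> 0)) \<longleftrightarrow>
      totally_decomposable scale n e d \<omega> \<and> \<omega> \<noteq> \<zero>\<^bsub>G\<^esub>" if "\<omega> \<in> degree_part d" for \<omega>
    unfolding totally_decomposable_iff_maximal_minors[OF that] degree_part_zero_iff[OF that] by metis
  then show ?thesis
    unfolding stiefel_spaces_def decomposables_def by blast
qed

text \<open>The coordinates of decomposable tensors are minors and so satisfy the Pluecker relations, and
  the linear space determines Pluecker vectors up to a scalar.\<close>

lemma L_injective_on_decomposables: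
  assumes "\<omega> \<in> decomposables d" "\<omega>' \<in> decomposables d" "L d \<omega> = L d \<omega>'"
  shows "proj_class scale n e \<omega> = proj_class scale n e \<omega>'"
proof -
  have deg: "\<omega> \<in> degree_part d" "\<omega>' \<in> degree_part d"
    using assms by (auto simp: decomposables_def)
  have pl: "tropical_pluecker n d (coord d \<omega>)" "\<exists>I\<in>index_sets n d. coord d \<omega> I \<noteq> 0"
    if "\<omega> \<in> decomposables d" for \<omega>
    using that totally_decomposable_iff_maximal_minors[of \<omega> d] degree_part_zero_iff[of \<omega> d]
    by (auto simp: decomposables_def intro: tropical_pluecker_maximal_minors)
  obtain t where t: "t \<noteq> 0" "\<And>I. I \<in> index_sets n d \<Longrightarrow> coord d \<omega>' I = t * coord d \<omega> I"
    using solutions_determine_pluecker_vector[OF pl[OF assms(1)] pl[OF assms(2)]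
      L_determines_solutions[OF assms(3)]] by blast
  have "\<omega>' = t \<odot>\<^bsub>G\<^esub> \<omega>"
    using deg t smult_in_degree_part by (intro degree_part_eqI[of _ d]) (simp_all add: coord_smult)
  then show ?thesis
    using proj_class_smult[OF deg(1) t(1)] by simp
qed

theorem bij_betw_L_class:
  "bij_betw (L_class scale n e d) (totally_decomposable_locus scale n e d) (stiefel_spaces scale n e d)"
  unfolding totally_decomposable_locus_eq stiefel_spaces_eq
proof (rule bij_betw_imageI)
  have L: "L_class scale n e d (proj_class scale n e \<omega>) = L d \<omega>" if "\<omega> \<in> decomposables d" for \<omega>
    using that by (intro L_class_proj_class) (simp add: decomposables_def)
  show "inj_on (L_class scale n e d) (proj_class scale n e ` decomposables d)"
  proof (rule inj_onI, elim imageE, goal_cases)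
    case (1 _ _ \<omega> \<omega>')
    then show ?case
      using L L_injective_on_decomposables[of \<omega> d \<omega>'] by simp
  qed
  show "L_class scale n e d ` proj_class scale n e ` decomposables d = L d ` decomposables d"
    by (auto simp: L image_image)
qed

end

theorem proposition5p2p1:
  fixes scale :: "'a::idempotent_semifield \<Rightarrow> 'v::comm_monoid_add \<Rightarrow> 'v"
    and n d :: nat
    and e :: "nat \<Rightarrow> 'v"
  assumes "free_semimodule scale n e"
  shows "(\<forall>\<omega>\<in>grassmann_deg scale n e d.
            totally_decomposable scale n e d \<omega> \<longleftrightarrow>
            (\<exists>M :: nat \<Rightarrow> nat \<Rightarrow> 'a. \<forall>I\<in>index_sets n d.
               grassmann_coord scale n e d \<omega> I = maximal_minor d M I)) \<and>
         bij_betw (L_class scale n e d)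
           (totally_decomposable_locus scale n e d)
           (stiefel_spaces scale n e d)"
proof -
  interpret free_semimodule scale n e
    by fact
  show ?thesis
    using totally_decomposable_iff_maximal_minors bij_betw_L_class by blast
qed

end
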